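(* Let $1.71\le\alpha\le\alpha_c(1)\approx 1.8159$. Then there exist $0<\eta_2^*<\beta_2^*<1$ and a constant $c^*>0$ such that the following holds: there exist $c'>0$ and $n_0$ such that for all $n\ge n_0$ and every $\mathcal{I}\subset[0,\pi/2]$ with $|\mathcal{I}|\le 2^{c^*n}$, \[ \mathbb{P}\bigl[\mathcal{S}(\beta_2^*,\eta_2^*,2,\alpha,\mathcal{I})\neq\varnothing\bigr]\le 2^{-c'n}. \]
   Context: Let $\mathcal{B}_n=\{-1,1\}^n$ and $\alpha_c(\kappa)=-1/\log_2\mathbb{P}[|Z|\le\kappa]$ with $Z\sim\mathcal{N}(0,1)$. Given $\alpha>0$, $m\in\mathbb{N}$, $0<\eta<\beta<1$ and $\mathcal{I}\subset[0,\pi/2]$, set $M=\lfloor n\alpha\rfloor$, let $\mathcal{M}_0,\dots,\mathcal{M}_m$ be i.i.d. $M\times n$ random matrices with i.i.d. $\mathcal{N}(0,1)$ entries and $\mathcal{M}_i(\tau)=\cos(\tau)\mathcal{M}_0+\sin(\tau)\mathcal{M}_i$. The random set $\mathcal{S}(\beta,\eta,m,\alpha,\mathcal{I})$ consists of all $(\sigma^{(1)},\dots,\sigma^{(m)})\in\mathcal{B}_n^m$ such that (a) $\beta-\eta\le n^{-1}\langle\sigma^{(i)},\sigma^{(j)}\rangle\le\beta$ for all $i<j$, and (b) there exist $\tau_1,\dots,\tau_m\in\mathcal{I}$ with $\|\mathcal{M}_i(\tau_i)\sigma^{(i)}\|_\infty\le\sqrt n$ for all $i$ (i.e. constraint width $\kappa=1$).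 *)

theory Defs
  imports "HOL-Probability.Probability"
begin

text \<open>
  Vectors of length \<open>n\<close> and \<open>M \<times> n\<close> matrices are functions on natural numbers that are only
  inspected at indices below \<open>n\<close> (and \<open>M\<close>), since the dimension grows along the statement.
\<close>

definition alpha_c :: "real \<Rightarrow> real" where
  "alpha_c \<kappa> = - 1 / log 2 (measure std_normal_distribution {z. \<bar>z\<bar> \<le> \<kappa>})"

definition cube :: "nat \<Rightarrow> (nat \<Rightarrow> real) set" where
  "cube n = {..<n} \<rightarrow>\<^sub>E {-1, 1}"

definition inner_n :: "nat \<Rightarrow> (nat \<Rightarrow> real) \<Rightarrow> (nat \<Rightarrow> real) \<Rightarrow> real" where
  "inner_n n u v = (\<Sum>k<n. u k * v k)"

definition mat_vec :: "nat \<Rightarrow> (nat \<Rightarrow> nat \<Rightarrow> real) \<Rightarrow> (nat \<Rightarrow> real) \<Rightarrow> (nat \<Rightarrow> real)" where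
  "mat_vec n A v = (\<lambda>r. inner_n n (A r) v)"

text \<open>The inserted \<open>0\<close> only matters for \<open>M = 0\<close>, where the norm of the empty vector is \<open>0\<close>.\<close>

definition linf_norm :: "nat \<Rightarrow> (nat \<Rightarrow> real) \<Rightarrow> real" where
  "linf_norm M v = Max (insert 0 ((\<lambda>r. \<bar>v r\<bar>) ` {..<M}))"

definition num_constraints :: "real \<Rightarrow> nat \<Rightarrow> nat" where
  "num_constraints \<alpha> n = nat \<lfloor>real n * \<alpha>\<rfloor>"

text \<open>
  The joint law of the independent matrices with indices \<open>0, \<dots>, m\<close>: the coordinate
  \<open>(i, r, k)\<close> of a sample point is the entry of the \<open>i\<close>-th matrix in row \<open>r\<close> and column \<open>k\<close>.
\<close>

definition gaussian_matrices :: "nat \<Rightarrow> nat \<Rightarrow> nat \<Rightarrow> (nat \<times> nat \<times> nat \<Rightarrow> real) measure" where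
  "gaussian_matrices m M n =
     (\<Pi>\<^sub>M _ \<in> {0..m} \<times> {..<M} \<times> {..<n}. std_normal_distribution)"

definition interpolated_matrix ::
    "(nat \<times> nat \<times> nat \<Rightarrow> real) \<Rightarrow> nat \<Rightarrow> real \<Rightarrow> (nat \<Rightarrow> nat \<Rightarrow> real)" where
  "interpolated_matrix \<omega> i \<tau> = (\<lambda>r k. cos \<tau> * \<omega> (0, r, k) + sin \<tau> * \<omega> (i, r, k))"

text \<open>The random set \<open>S(\<beta>, \<eta>, m, \<alpha>, I)\<close> in dimension \<open>n\<close>, evaluated at the sample point \<open>\<omega>\<close>.\<close>

definition overlap_set ::
    "real \<Rightarrow> real \<Rightarrow> nat \<Rightarrow> real \<Rightarrow> real set \<Rightarrow> nat \<Rightarrow> (nat \<times> nat \<times> nat \<Rightarrow> real)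
      \<Rightarrow> (nat \<Rightarrow> nat \<Rightarrow> real) set" where
  "overlap_set \<beta> \<eta> m \<alpha> I n \<omega> =
     {\<sigma> \<in> {1..m} \<rightarrow>\<^sub>E cube n.
        (\<forall>i\<in>{1..m}. \<forall>j\<in>{1..m}. i < j \<longrightarrow>
           \<beta> - \<eta> \<le> inner_n n (\<sigma> i) (\<sigma> j) / real n \<and> inner_n n (\<sigma> i) (\<sigma> j) / real n \<le> \<beta>) \<and>
        (\<exists>\<tau>. \<forall>i\<in>{1..m}. \<tau> i \<in> I \<and>
           linf_norm (num_constraints \<alpha> n) (mat_vec n (interpolated_matrix \<omega> i (\<tau> i)) (\<sigma> i))
             \<le> sqrt (real n))}"

text \<open>
  For finite \<open>I\<close> the event below is a finite union of measurable sets, so \<open>measure\<close> does not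
  take its default value \<open>0\<close>.
\<close>

definition prob_overlap_set_nonempty ::
    "real \<Rightarrow> real \<Rightarrow> nat \<Rightarrow> real \<Rightarrow> real set \<Rightarrow> nat \<Rightarrow> real" where
  "prob_overlap_set_nonempty \<beta> \<eta> m \<alpha> I n =
     measure (gaussian_matrices m (num_constraints \<alpha> n) n)
       {\<omega> \<in> space (gaussian_matrices m (num_constraints \<alpha> n) n). overlap_set \<beta> \<eta> m \<alpha> I n \<omega> \<noteq> {}}"

end

theory Submission
  imports Defs
begin

text \<open>
  First moment method. For a fixed pair of sign vectors with overlap \<open>\<rho>\<close> and fixed angles, every row
  contributes a pair of standard Gaussians of correlation \<open>r = cos \<tau>\<^sub>1 cos \<tau>\<^sub>2 \<rho> \<in> [0, \<beta>]\<close>, and rows are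
  independent. In independent coordinates the event \<open>|X| \<le> 1, |Y| \<le> 1\<close> is a rhombus, whose complement
  is a union of four congruent wedges; by Owen's formula the probability of a wedge is an explicit integral
  that is monotone in \<open>r\<close>. With \<open>\<beta> = 63/65\<close> the rhombus has probability at most \<open>q = 0.6355\<close>.
  The number of pairs that differ in at most \<open>n/64\<close> coordinates is at most
  \<open>(2 \<cdot> 64/63 \<cdot> 63^(1/64))^n\<close>, and \<open>2 \<cdot> 64/63 \<cdot> 63^(1/64) \<cdot> q^1.71 < 1\<close> leaves room for the
  \<open>|I|\<^sup>2\<close> choices of the two angles.
\<close>

section \<open>Pairs of linear forms in Gaussian variables\<close>

text \<open>For \<alpha> below \<open>alpha_c 1\<close> the expected number of single solutions is
  exponentially large, and the exponential rate for pairs tends to the same value as the overlap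
  tends to 1. So the overlap must stay far enough from 1 for the second vector to lower the row
  probability by more than the entropy of choosing it. The upper end of the overlap window governs
  the row probability, the lower end the number of pairs; hence a narrow window, from
  \<open>31/32\<close> to \<open>63/65\<close>. The latter is the cosine of the angle whose half has
  tangent \<open>1/8\<close>, so that the diagonals of the extremal rhombus have rational slopes
  \<open>1/8\<close> and \<open>-8\<close>. Nonnegative cosines can only shrink the correlation, and
  monotonicity then makes this one rhombus the worst case for all angles. The margin is thin: the
  base of the final exponential is only shown to be below about 0.9993, which dictates the precision
  of the numerical bounds. Planar Gaussian invariance is used for reflections, which are their own
  inverses: the one with entries \<open>r, c, c, - r\<close> exchanges \<open>x\<close> and
  \<open>r * x + c * y\<close>.\<close>

lemma std_normal_reflection:
  fixes f :: "real \<times> real \<Rightarrow> ennreal"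
  assumes [measurable]: "f \<in> borel_measurable (borel \<Otimes>\<^sub>M borel)" and cs: "c\<^sup>2 + s\<^sup>2 = 1"
  shows "(\<integral>\<^sup>+x. \<integral>\<^sup>+y. f (c * x + s * y, s * x - c * y) \<partial>std_normal_distribution \<partial>std_normal_distribution)
       = (\<integral>\<^sup>+x. \<integral>\<^sup>+y. f (x, y) \<partial>std_normal_distribution \<partial>std_normal_distribution)"
proof -
  define \<phi> where "\<phi> x y = std_normal_density x * std_normal_density y" for x y
  define g where "g = (\<lambda>(x, y). f (x, y) * ennreal (\<phi> x y))"
  have [measurable]: "g \<in> borel_measurable (borel \<Otimes>\<^sub>M borel)"
    unfolding g_def \<phi>_def by measurable
  have \<phi>_eq: "\<phi> x y = exp (- (x\<^sup>2 + y\<^sup>2) / 2) / (2 * pi)" for x y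
    by (simp add: \<phi>_def std_normal_density_def exp_add[symmetric] field_simps real_sqrt_mult)
  have norm: "(c * x + s * y)\<^sup>2 + (s * x - c * y)\<^sup>2 = x\<^sup>2 + y\<^sup>2" for x y
  proof -
    have "(c * x + s * y)\<^sup>2 + (s * x - c * y)\<^sup>2 = (c\<^sup>2 + s\<^sup>2) * (x\<^sup>2 + y\<^sup>2)" by algebra
    then show ?thesis using cs by simp
  qed
  have \<phi>_inv: "\<phi> (c * x + s * y) (s * x - c * y) = \<phi> x y" for x y
    unfolding \<phi>_eq norm ..
  have dens: "(\<integral>\<^sup>+x. \<integral>\<^sup>+y. F (x, y) \<partial>std_normal_distribution \<partial>std_normal_distribution)
      = (\<integral>\<^sup>+x. \<integral>\<^sup>+y. F (x, y) * ennreal (\<phi> x y) \<partial>lborel \<partial>lborel)"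
    if [measurable]: "F \<in> borel_measurable (borel \<Otimes>\<^sub>M borel)" for F :: "real \<times> real \<Rightarrow> ennreal"
    by (auto simp: nn_integral_density nn_integral_cmult[symmetric] \<phi>_def ennreal_mult ac_simps
        intro!: nn_integral_cong)
  have lhs: "(\<integral>\<^sup>+x. \<integral>\<^sup>+y. f (c * x + s * y, s * x - c * y) \<partial>std_normal_distribution \<partial>std_normal_distribution)
      = (\<integral>\<^sup>+x. \<integral>\<^sup>+y. g (c * x + s * y, s * x - c * y) \<partial>lborel \<partial>lborel)"
    by (subst dens[where F="\<lambda>(x, y). f (c * x + s * y, s * x - c * y)", simplified])
       (simp_all add: g_def \<phi>_inv)
  have "(\<integral>\<^sup>+x. \<integral>\<^sup>+y. g (c * x + s * y, s * x - c * y) \<partial>lborel \<partial>lborel)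
      = (\<integral>\<^sup>+x. \<integral>\<^sup>+y. g (x, y) \<partial>lborel \<partial>lborel)"
  \<comment> \<open>The substitutions below divide by \<open>s\<close>; for \<open>s = 0\<close> the
    map flips the sign of a single coordinate.\<close>
  proof (cases "s = 0")
    case True
    with cs have "c = 1 \<or> c = -1" by (simp add: power2_eq_1_iff)
    then show ?thesis
    proof
      assume c: "c = 1"
      have "(\<integral>\<^sup>+y. g (x, y) \<partial>lborel) = (\<integral>\<^sup>+y. g (x, - y) \<partial>lborel)" for x
        by (subst nn_integral_real_affine[where c="-1" and t=0]) auto
      then show ?thesis using True c by simp
    next
      assume c: "c = -1"
      have "(\<integral>\<^sup>+x. \<integral>\<^sup>+y. g (x, y) \<partial>lborel \<partial>lborel) = (\<integral>\<^sup>+x. \<integral>\<^sup>+y. g (- x, y) \<partial>lborel \<partial>lborel)"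
        by (subst nn_integral_real_affine[where c="-1" and t=0]) auto
      then show ?thesis using True c by simp
    qed
  next
    case False
    \<comment> \<open>For fixed \<open>x\<close> put \<open>z = c * x + s * y\<close>; after
      exchanging the integrals put \<open>x = c * z + s * y\<close> for fixed \<open>z\<close>. The
      two Jacobians cancel.\<close>
    have 1: "\<bar>s\<bar> * (\<integral>\<^sup>+y. g (c * x + s * y, s * x - c * y) \<partial>lborel)
        = (\<integral>\<^sup>+z. g (z, (x - c * z) / s) \<partial>lborel)" for x
    proof -
      have e: "(x - c * (c * x + s * y)) / s = s * x - c * y" for y
      proof -
        have "x - c * (c * x + s * y) = (1 - c\<^sup>2) * x - c * s * y" by algebra
        also have "1 - c\<^sup>2 = s\<^sup>2" using cs by simp
        also have "s\<^sup>2 * x - c * s * y = s * (s * x - c * y)" by algebra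
        finally show ?thesis using False by simp
      qed
      show ?thesis
        by (subst (2) nn_integral_real_affine[OF _ False, where t="c * x"]) (use e in auto)
    qed
    have 2: "(\<integral>\<^sup>+x. g (z, (x - c * z) / s) \<partial>lborel) = \<bar>s\<bar> * (\<integral>\<^sup>+y. g (z, y) \<partial>lborel)" for z
      by (subst nn_integral_real_affine[OF _ False, where t="c * z"]) (use False in auto)
    have "\<bar>s\<bar> * (\<integral>\<^sup>+x. \<integral>\<^sup>+y. g (c * x + s * y, s * x - c * y) \<partial>lborel \<partial>lborel)
        = (\<integral>\<^sup>+x. \<integral>\<^sup>+z. g (z, (x - c * z) / s) \<partial>lborel \<partial>lborel)"
      by (subst nn_integral_cmult[symmetric]) (auto simp: 1)
    also have "\<dots> = (\<integral>\<^sup>+z. \<integral>\<^sup>+x. g (z, (x - c * z) / s) \<partial>lborel \<partial>lborel)"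
      by (rule lborel_pair.Fubini') simp
    also have "\<dots> = \<bar>s\<bar> * (\<integral>\<^sup>+x. \<integral>\<^sup>+y. g (x, y) \<partial>lborel \<partial>lborel)"
      by (subst nn_integral_cmult[symmetric]) (auto simp: 2)
    finally show ?thesis
      using False by (simp add: ennreal_mult_cancel_left)
  qed
  also have "\<dots> = (\<integral>\<^sup>+x. \<integral>\<^sup>+y. f (x, y) \<partial>std_normal_distribution \<partial>std_normal_distribution)"
    by (subst dens) (simp_all add: g_def)
  finally show ?thesis using lhs by simp
qed

lemma prob_space_std_normal: "prob_space std_normal_distribution"
  by (rule prob_space_normal_density) simp

text \<open>A reflection whose first axis points along \<open>(a, b)\<close> turns the form into a
  multiple of the first coordinate, and the other coordinate integrates to 1. Only
  \<open>a = b = 0\<close> lacks such a direction.\<close>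

lemma std_normal_linear_combination:
  fixes g :: "real \<Rightarrow> ennreal"
  assumes [measurable]: "g \<in> borel_measurable borel"
  shows "(\<integral>\<^sup>+x. \<integral>\<^sup>+y. g (a * x + b * y) \<partial>std_normal_distribution \<partial>std_normal_distribution)
       = (\<integral>\<^sup>+x. g (sqrt (a\<^sup>2 + b\<^sup>2) * x) \<partial>std_normal_distribution)"
proof -
  interpret prob_space std_normal_distribution by (rule prob_space_std_normal)
  define d where "d = sqrt (a\<^sup>2 + b\<^sup>2)"
  have d2: "d\<^sup>2 = a\<^sup>2 + b\<^sup>2" by (simp add: d_def)
  show ?thesis
  proof (cases "d = 0")
    case True
    then have "a = 0" "b = 0" using d2 by (simp_all add: sum_power2_eq_zero_iff)
    then show ?thesis by (simp add: emeasure_space_1[simplified])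
  next
    case False
    have e: "a * (a / d * x + b / d * y) + b * (b / d * x - a / d * y) = d * x" for x y
    proof -
      have "a * (a / d * x + b / d * y) + b * (b / d * x - a / d * y) = (a\<^sup>2 + b\<^sup>2) / d * x"
        by (simp add: power2_eq_square algebra_simps add_divide_distrib)
      also have "(a\<^sup>2 + b\<^sup>2) / d = d" using False d2 by (metis nonzero_mult_div_cancel_left power2_eq_square)
      finally show ?thesis .
    qed
    have "(a / d)\<^sup>2 + (b / d)\<^sup>2 = 1"
      using False unfolding power_divide add_divide_distrib[symmetric] d2[symmetric] by simp
    then have "(\<integral>\<^sup>+x. \<integral>\<^sup>+y. g (a * x + b * y) \<partial>std_normal_distribution \<partial>std_normal_distribution)
      = (\<integral>\<^sup>+x. \<integral>\<^sup>+y. g (a * (a / d * x + b / d * y) + b * (b / d * x - a / d * y))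
           \<partial>std_normal_distribution \<partial>std_normal_distribution)"
      by (subst std_normal_reflection[where c="a / d" and s="b / d"
            and f="\<lambda>(x, y). g (a * x + b * y)", symmetric, simplified]) auto
    also have "\<dots> = (\<integral>\<^sup>+x. g (d * x) \<partial>std_normal_distribution)"
      by (simp only: e) (simp add: emeasure_space_1[simplified])
    finally show ?thesis by (simp add: d_def)
  qed
qed

lemma std_normal_fubini:
  assumes [measurable]: "case_prod f \<in> borel_measurable (borel \<Otimes>\<^sub>M borel)"
  shows "(\<integral>\<^sup>+x. \<integral>\<^sup>+y. f x y \<partial>std_normal_distribution \<partial>std_normal_distribution)
    = (\<integral>\<^sup>+y. \<integral>\<^sup>+x. f x y \<partial>std_normal_distribution \<partial>std_normal_distribution)"
proof -
  interpret prob_space std_normal_distribution by (rule prob_space_std_normal)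
  interpret pair_sigma_finite std_normal_distribution std_normal_distribution ..
  show ?thesis by (rule Fubini') simp
qed

text \<open>
  One step of Gram--Schmidt: a Gaussian pair \<open>(a U, b U + c V)\<close> perturbed by a fresh Gaussian
  in the direction \<open>(u, v)\<close> can be brought back to triangular form by reflections.
\<close>

lemma std_normal_triangular_step:
  fixes a b c u v :: real
  obtains a' b' c' :: real where "0 \<le> a'" "0 \<le> c'" "a'\<^sup>2 = a\<^sup>2 + u\<^sup>2" "a' * b' = a * b + u * v"
    "b'\<^sup>2 + c'\<^sup>2 = b\<^sup>2 + c\<^sup>2 + v\<^sup>2"
    "\<And>f :: real \<times> real \<Rightarrow> ennreal. f \<in> borel_measurable (borel \<Otimes>\<^sub>M borel) \<Longrightarrow>
      (\<integral>\<^sup>+z. \<integral>\<^sup>+x. \<integral>\<^sup>+y. f (a * x + u * z, b * x + c * y + v * z)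
         \<partial>std_normal_distribution \<partial>std_normal_distribution \<partial>std_normal_distribution)
      = (\<integral>\<^sup>+x. \<integral>\<^sup>+y. f (a' * x, b' * x + c' * y) \<partial>std_normal_distribution \<partial>std_normal_distribution)"
proof (cases "a\<^sup>2 + u\<^sup>2 = 0")
  \<comment> \<open>The first form vanishes and gives no direction to reflect along; all variance of
    the second goes into \<open>c'\<close>, with \<open>a' = b' = 0\<close>.\<close>
  case True
  then have au: "a = 0" "u = 0" by (simp_all add: sum_power2_eq_zero_iff)
  interpret prob_space std_normal_distribution by (rule prob_space_std_normal)
  define d where "d = sqrt (b\<^sup>2 + c\<^sup>2)"
  define e where "e = sqrt (v\<^sup>2 + d\<^sup>2)"
  have "(\<integral>\<^sup>+z. \<integral>\<^sup>+x. \<integral>\<^sup>+y. f (0, b * x + c * y + v * z)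
         \<partial>std_normal_distribution \<partial>std_normal_distribution \<partial>std_normal_distribution)
      = (\<integral>\<^sup>+y. f (0, e * y) \<partial>std_normal_distribution)"
    if [measurable]: "f \<in> borel_measurable (borel \<Otimes>\<^sub>M borel)" for f :: "real \<times> real \<Rightarrow> ennreal"
  proof -
    have "(\<integral>\<^sup>+x. \<integral>\<^sup>+y. f (0, b * x + c * y + v * z) \<partial>std_normal_distribution \<partial>std_normal_distribution)
       = (\<integral>\<^sup>+x. f (0, v * z + d * x) \<partial>std_normal_distribution)" for z
      using std_normal_linear_combination[of "\<lambda>w. f (0, w + v * z)" b c] by (simp add: d_def add.commute)
    then show ?thesis
      using std_normal_linear_combination[of "\<lambda>w. f (0, w)" v d] by (simp add: e_def)
  qed
  then show thesis
    by (intro that[of 0 e 0]) (auto simp: au e_def d_def emeasure_space_1[simplified])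
next
  case False
  define d where "d = sqrt (a\<^sup>2 + u\<^sup>2)"
  have d2: "d\<^sup>2 = a\<^sup>2 + u\<^sup>2" by (simp add: d_def)
  have d0: "d > 0" using False by (simp add: d_def sum_power2_gt_zero_iff sum_power2_eq_zero_iff)
  define p where "p = a / d"
  define s where "s = u / d"
  have a: "a = d * p" and u: "u = d * s" using d0 by (simp_all add: p_def s_def)
  have ps: "p\<^sup>2 + s\<^sup>2 = 1"
    using d0 unfolding p_def s_def power_divide add_divide_distrib[symmetric] d2[symmetric] by simp
  \<comment> \<open>Reflecting the \<open>(x, z)\<close> plane by \<open>(p, s)\<close> turns the
    first form into \<open>d * x\<close> and the second into \<open>b' * x + c1 * z + c * y\<close>;
    the last two terms then merge into \<open>c' * y\<close>.\<close>
  define b' where "b' = b * p + v * s"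
  define c1 where "c1 = b * s - v * p"
  define c' where "c' = sqrt (c1\<^sup>2 + c\<^sup>2)"
  show thesis
  proof (rule that[of d c' b'])
    show "0 \<le> d" "0 \<le> c'" "d\<^sup>2 = a\<^sup>2 + u\<^sup>2" using d0 d2 by (simp_all add: c'_def)
    show "d * b' = a * b + u * v" by (simp add: b'_def a u algebra_simps)
    have "b'\<^sup>2 + c1\<^sup>2 = (p\<^sup>2 + s\<^sup>2) * (b\<^sup>2 + v\<^sup>2)" unfolding b'_def c1_def by algebra
    then show "b'\<^sup>2 + c'\<^sup>2 = b\<^sup>2 + c\<^sup>2 + v\<^sup>2" by (simp add: c'_def ps)
    fix f :: "real \<times> real \<Rightarrow> ennreal"
    assume [measurable]: "f \<in> borel_measurable (borel \<Otimes>\<^sub>M borel)"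
    interpret prob_space std_normal_distribution by (rule prob_space_std_normal)
    define F where "F = (\<lambda>(x, z). \<integral>\<^sup>+y. f (a * x + u * z, b * x + c * y + v * z) \<partial>std_normal_distribution)"
    have [measurable]: "F \<in> borel_measurable (borel \<Otimes>\<^sub>M borel)"
      unfolding F_def by measurable
    have "(\<integral>\<^sup>+z. \<integral>\<^sup>+x. \<integral>\<^sup>+y. f (a * x + u * z, b * x + c * y + v * z)
         \<partial>std_normal_distribution \<partial>std_normal_distribution \<partial>std_normal_distribution)
      = (\<integral>\<^sup>+x. \<integral>\<^sup>+z. F (x, z) \<partial>std_normal_distribution \<partial>std_normal_distribution)"
      by (subst std_normal_fubini) (simp_all add: F_def)
    also have "\<dots> = (\<integral>\<^sup>+x. \<integral>\<^sup>+z. F (p * x + s * z, s * x - p * z) \<partial>std_normal_distribution \<partial>std_normal_distribution)"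
      by (rule std_normal_reflection[symmetric]) (simp_all add: ps)
    also have "\<dots> = (\<integral>\<^sup>+x. \<integral>\<^sup>+z. \<integral>\<^sup>+y. f (d * x, b' * x + (c1 * z + c * y))
        \<partial>std_normal_distribution \<partial>std_normal_distribution \<partial>std_normal_distribution)"
    proof -
      have 1: "a * (p * x + s * z) + u * (s * x - p * z) = d * x" for x z
      proof -
        have "a * (p * x + s * z) + u * (s * x - p * z) = d * x * (p\<^sup>2 + s\<^sup>2)" unfolding a u by algebra
        then show ?thesis by (simp add: ps)
      qed
      have 2: "b * (p * x + s * z) + c * y + v * (s * x - p * z) = b' * x + (c1 * z + c * y)" for x y z
        by (simp add: b'_def c1_def algebra_simps)
      show ?thesis by (simp add: F_def 1 2)
    qed
    also have "\<dots> = (\<integral>\<^sup>+x. \<integral>\<^sup>+y. f (d * x, b' * x + c' * y) \<partial>std_normal_distribution \<partial>std_normal_distribution)"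
      unfolding c'_def
      by (intro nn_integral_cong std_normal_linear_combination[where g="\<lambda>w. f (d * _, b' * _ + w)"]) simp
    finally show "(\<integral>\<^sup>+z. \<integral>\<^sup>+x. \<integral>\<^sup>+y. f (a * x + u * z, b * x + c * y + v * z)
         \<partial>std_normal_distribution \<partial>std_normal_distribution \<partial>std_normal_distribution)
      = (\<integral>\<^sup>+x. \<integral>\<^sup>+y. f (d * x, b' * x + c' * y) \<partial>std_normal_distribution \<partial>std_normal_distribution)" .
  qed
qed

text \<open>Induction over the coordinates, restoring at each step the Cholesky form of the 2 by 2
  covariance. The law ranges over all test functions because the step applies it to \<open>f\<close>
  shifted by the fresh coordinate; prescribing \<open>a * b\<close> avoids dividing by
  \<open>a\<close>, which may be 0.\<close>

lemma std_normal_PiM_linear_pair: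
  fixes u v :: "'i \<Rightarrow> real"
  assumes "finite J"
  shows "\<exists>a b c. 0 \<le> a \<and> 0 \<le> c \<and> a\<^sup>2 = (\<Sum>j\<in>J. (u j)\<^sup>2) \<and> a * b = (\<Sum>j\<in>J. u j * v j) \<and>
    b\<^sup>2 + c\<^sup>2 = (\<Sum>j\<in>J. (v j)\<^sup>2) \<and>
    (\<forall>f :: real \<times> real \<Rightarrow> ennreal. f \<in> borel_measurable (borel \<Otimes>\<^sub>M borel) \<longrightarrow>
      (\<integral>\<^sup>+\<omega>. f (\<Sum>j\<in>J. u j * \<omega> j, \<Sum>j\<in>J. v j * \<omega> j) \<partial>(\<Pi>\<^sub>M _\<in>J. std_normal_distribution))
      = (\<integral>\<^sup>+x. \<integral>\<^sup>+y. f (a * x, b * x + c * y) \<partial>std_normal_distribution \<partial>std_normal_distribution))"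
  using assms
proof (induction J)
  case empty
  interpret prob_space std_normal_distribution by (rule prob_space_std_normal)
  show ?case
    by (intro exI[of _ 0]) (simp add: emeasure_space_1[simplified] PiM_empty)
next
  case (insert i J)
  then obtain a b c where IH: "0 \<le> a" "0 \<le> c" "a\<^sup>2 = (\<Sum>j\<in>J. (u j)\<^sup>2)" "a * b = (\<Sum>j\<in>J. u j * v j)"
    "b\<^sup>2 + c\<^sup>2 = (\<Sum>j\<in>J. (v j)\<^sup>2)"
    and law: "\<And>f :: real \<times> real \<Rightarrow> ennreal. f \<in> borel_measurable (borel \<Otimes>\<^sub>M borel) \<Longrightarrow>
      (\<integral>\<^sup>+\<omega>. f (\<Sum>j\<in>J. u j * \<omega> j, \<Sum>j\<in>J. v j * \<omega> j) \<partial>(\<Pi>\<^sub>M _\<in>J. std_normal_distribution))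
      = (\<integral>\<^sup>+x. \<integral>\<^sup>+y. f (a * x, b * x + c * y) \<partial>std_normal_distribution \<partial>std_normal_distribution)"
    by blast
  interpret prob_space std_normal_distribution by (rule prob_space_std_normal)
  interpret product_sigma_finite "\<lambda>_::'i. std_normal_distribution" ..
  obtain a' b' c' where step: "0 \<le> a'" "0 \<le> c'" "a'\<^sup>2 = a\<^sup>2 + (u i)\<^sup>2" "a' * b' = a * b + u i * v i"
    "b'\<^sup>2 + c'\<^sup>2 = b\<^sup>2 + c\<^sup>2 + (v i)\<^sup>2"
    "\<And>f :: real \<times> real \<Rightarrow> ennreal. f \<in> borel_measurable (borel \<Otimes>\<^sub>M borel) \<Longrightarrow>
      (\<integral>\<^sup>+z. \<integral>\<^sup>+x. \<integral>\<^sup>+y. f (a * x + u i * z, b * x + c * y + v i * z)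
         \<partial>std_normal_distribution \<partial>std_normal_distribution \<partial>std_normal_distribution)
      = (\<integral>\<^sup>+x. \<integral>\<^sup>+y. f (a' * x, b' * x + c' * y) \<partial>std_normal_distribution \<partial>std_normal_distribution)"
    using std_normal_triangular_step[of a "u i" b "v i" c thesis] by blast
  have "(\<integral>\<^sup>+\<omega>. f (\<Sum>j\<in>insert i J. u j * \<omega> j, \<Sum>j\<in>insert i J. v j * \<omega> j)
          \<partial>(\<Pi>\<^sub>M _\<in>insert i J. std_normal_distribution))
      = (\<integral>\<^sup>+x. \<integral>\<^sup>+y. f (a' * x, b' * x + c' * y) \<partial>std_normal_distribution \<partial>std_normal_distribution)"
    if [measurable]: "f \<in> borel_measurable (borel \<Otimes>\<^sub>M borel)" for f :: "real \<times> real \<Rightarrow> ennreal"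
  proof -
    have upd: "(\<Sum>j\<in>J. w j * (x(i := y)) j) = (\<Sum>j\<in>J. w j * x j)" for w x and y :: real
      using insert.hyps by (intro sum.cong) auto
    have "(\<integral>\<^sup>+\<omega>. f (\<Sum>j\<in>insert i J. u j * \<omega> j, \<Sum>j\<in>insert i J. v j * \<omega> j)
          \<partial>(\<Pi>\<^sub>M _\<in>insert i J. std_normal_distribution))
       = (\<integral>\<^sup>+z. \<integral>\<^sup>+\<omega>. f (u i * z + (\<Sum>j\<in>J. u j * \<omega> j), v i * z + (\<Sum>j\<in>J. v j * \<omega> j))
          \<partial>(\<Pi>\<^sub>M _\<in>J. std_normal_distribution) \<partial>std_normal_distribution)"
      using insert.hyps
      by (subst product_nn_integral_insert_rev) (simp_all add: upd del: fun_upd_apply, simp add: upd)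
    also have "\<dots> = (\<integral>\<^sup>+z. \<integral>\<^sup>+x. \<integral>\<^sup>+y. f (a * x + u i * z, b * x + c * y + v i * z)
         \<partial>std_normal_distribution \<partial>std_normal_distribution \<partial>std_normal_distribution)"
      by (intro nn_integral_cong, subst law[where f="\<lambda>(p, q). f (u i * _ + p, v i * _ + q)", simplified])
         (simp_all add: algebra_simps)
    also note step(6)[OF that]
    finally show ?thesis .
  qed
  then show ?case
    using step(1-5) IH insert.hyps
    by (intro exI[of _ a'] exI[of _ b'] exI[of _ c']) (auto simp: algebra_simps)
qed

section \<open>The probability of a rhombus\<close>

text \<open>The integrand of Owen's T function \<open>T(1, a)\<close>.\<close>

definition owen_density :: "real \<Rightarrow> real" where
  "owen_density x = exp (- (1 + x\<^sup>2) / 2) / (2 * pi * (1 + x\<^sup>2))"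

lemma one_plus_square_pos: "0 < 1 + (x::real)\<^sup>2"
  by (rule add_pos_nonneg) simp_all

lemma owen_density_pos: "0 < owen_density x"
  unfolding owen_density_def using one_plus_square_pos[of x] by simp

lemma isCont_owen_density: "isCont owen_density x"
  unfolding owen_density_def using one_plus_square_pos[of x] by (intro continuous_intros) auto

lemma measurable_owen_density [measurable]: "owen_density \<in> borel_measurable borel"
  unfolding owen_density_def[abs_def] by measurable

text \<open>The factor \<open>x\<close> is the Jacobian of \<open>y = x * z\<close>; it makes the
  integrand an exact derivative.\<close>

lemma nn_integral_owen_density:
  "(\<integral>\<^sup>+x. ennreal (std_normal_density x * (x * std_normal_density (x * z))) * indicator {1..} x \<partial>lborel)
    = ennreal (owen_density z)"
proof -
  have z: "0 < 1 + z\<^sup>2" by (rule one_plus_square_pos)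
  define k where "k = 1 + z\<^sup>2"
  have k: "0 < k" using z by (simp add: k_def)
  define F where "F x = - exp (- x\<^sup>2 * k / 2) / (2 * pi * k)" for x
  have e: "std_normal_density x * (x * std_normal_density (x * z)) = x * exp (- x\<^sup>2 * k / 2) / (2 * pi)" for x
    by (simp add: k_def std_normal_density_def exp_add[symmetric] field_simps real_sqrt_mult power_mult_distrib)
  have "(\<integral>\<^sup>+x. ennreal (std_normal_density x * (x * std_normal_density (x * z))) * indicator {1..} x \<partial>lborel)
    = ennreal (0 - F 1)"
  proof (rule nn_integral_FTC_atLeast)
    show "(F has_real_derivative std_normal_density x * (x * std_normal_density (x * z))) (at x)" for x
      unfolding F_def e using k by (auto intro!: derivative_eq_intros)
    have "((\<lambda>x::real. exp (- (k / 2 * x\<^sup>2))) \<longlongrightarrow> 0) at_top"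
      using k by (intro filterlim_compose[OF exp_at_bot] filterlim_compose[OF filterlim_uminus_at_bot_at_top]
          filterlim_tendsto_pos_mult_at_top[OF tendsto_const] filterlim_pow_at_top filterlim_ident) auto
    then have "((\<lambda>x::real. - exp (- (k / 2 * x\<^sup>2)) / (2 * pi * k)) \<longlongrightarrow> - 0 / (2 * pi * k)) at_top"
      using k by (intro tendsto_intros) auto
    then show "(F \<longlongrightarrow> 0) at_top" by (simp add: F_def[abs_def] mult.commute)
  qed auto
  also have "0 - F 1 = owen_density z"
    by (simp add: F_def owen_density_def k_def)
  finally show ?thesis .
qed

text \<open>
  Owen's formula: rescaling the second coordinate by the first turns the wedge into a
  product, over which the radial integral is elementary.
\<close>

lemma nn_integral_std_normal_wedge:
  "(\<integral>\<^sup>+x. \<integral>\<^sup>+y. indicator {(x, y). 1 < x \<and> \<alpha> * x < y \<and> y < \<beta> * x} (x, y)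
      \<partial>std_normal_distribution \<partial>std_normal_distribution)
    = (\<integral>\<^sup>+z. ennreal (owen_density z) * indicator {\<alpha>..\<beta>} z \<partial>lborel)"
proof -
  have "(\<integral>\<^sup>+x. \<integral>\<^sup>+y. indicator {(x, y). 1 < x \<and> \<alpha> * x < y \<and> y < \<beta> * x} (x, y)
      \<partial>std_normal_distribution \<partial>std_normal_distribution)
    = (\<integral>\<^sup>+x. ennreal (std_normal_density x) * (indicator {1<..} x *
        (\<integral>\<^sup>+y. ennreal (std_normal_density y) * indicator {\<alpha> * x <..< \<beta> * x} y \<partial>lborel)) \<partial>lborel)"
    by (subst nn_integral_density, measurable)
       (auto simp: nn_integral_density indicator_def intro!: nn_integral_cong arg_cong2[where f="(*)"])
  also have "\<dots> = (\<integral>\<^sup>+x. \<integral>\<^sup>+z. ennreal (std_normal_density x * (x * std_normal_density (x * z)))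
        * indicator {1<..} x * indicator {\<alpha><..<\<beta>} z \<partial>lborel \<partial>lborel)"
  proof (rule nn_integral_cong)
    fix x :: real
    show "ennreal (std_normal_density x) * (indicator {1<..} x *
        (\<integral>\<^sup>+y. ennreal (std_normal_density y) * indicator {\<alpha> * x <..< \<beta> * x} y \<partial>lborel))
      = (\<integral>\<^sup>+z. ennreal (std_normal_density x * (x * std_normal_density (x * z)))
        * indicator {1<..} x * indicator {\<alpha><..<\<beta>} z \<partial>lborel)"
    proof (cases "1 < x")
      case True
      have i: "indicator {\<alpha> * x <..< \<beta> * x} (x * z) = (indicator {\<alpha><..<\<beta>} z :: ennreal)" for z
        using True by (auto simp: indicator_def mult.commute[of _ x])
      have "(\<integral>\<^sup>+y. ennreal (std_normal_density y) * indicator {\<alpha> * x <..< \<beta> * x} y \<partial>lborel)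
        = ennreal x * (\<integral>\<^sup>+z. ennreal (std_normal_density (x * z)) * indicator {\<alpha><..<\<beta>} z \<partial>lborel)"
        using True by (subst nn_integral_real_affine[where c=x and t=0]) (auto simp: i)
      then show ?thesis
        using True
        by (simp add: nn_integral_cmult[symmetric] ennreal_mult mult.assoc)
    qed simp
  qed
  also have "\<dots> = (\<integral>\<^sup>+z. \<integral>\<^sup>+x. ennreal (std_normal_density x * (x * std_normal_density (x * z)))
        * indicator {1<..} x * indicator {\<alpha><..<\<beta>} z \<partial>lborel \<partial>lborel)"
    by (rule lborel_pair.Fubini') simp
  also have "\<dots> = (\<integral>\<^sup>+z. ennreal (owen_density z) * indicator {\<alpha><..<\<beta>} z \<partial>lborel)"
  proof (rule nn_integral_cong)
    fix z :: real
    have "(\<integral>\<^sup>+x. ennreal (std_normal_density x * (x * std_normal_density (x * z))) * indicator {1<..} x \<partial>lborel)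
      = (\<integral>\<^sup>+x. ennreal (std_normal_density x * (x * std_normal_density (x * z))) * indicator {1..} x \<partial>lborel)"
      using AE_lborel_singleton[of "1::real"]
      by (intro nn_integral_cong_AE) (auto elim!: eventually_mono simp: indicator_def)
    then show "(\<integral>\<^sup>+x. ennreal (std_normal_density x * (x * std_normal_density (x * z)))
        * indicator {1<..} x * indicator {\<alpha><..<\<beta>} z \<partial>lborel)
        = ennreal (owen_density z) * indicator {\<alpha><..<\<beta>} z"
      by (simp add: nn_integral_owen_density nn_integral_multc)
  qed
  also have "\<dots> = (\<integral>\<^sup>+z. ennreal (owen_density z) * indicator {\<alpha>..\<beta>} z \<partial>lborel)"
    using AE_lborel_singleton[of \<alpha>] AE_lborel_singleton[of \<beta>]
    by (intro nn_integral_cong_AE, eventually_elim) (auto simp: indicator_def)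
  finally show ?thesis .
qed

section \<open>Wedge probabilities as differences of a primitive\<close>

lemma owen_antiderivative: "\<exists>H. \<forall>x. (H has_real_derivative owen_density x) (at x)"
proof -
  obtain H where "\<And>x. -\<infinity> < ereal x \<Longrightarrow> ereal x < \<infinity> \<Longrightarrow> (H has_vector_derivative owen_density x) (at x)"
    using einterval_antiderivative[of "-\<infinity>" "\<infinity>" owen_density] isCont_owen_density by auto
  then show ?thesis
    by (intro exI[of _ H]) (simp add: has_real_derivative_iff_has_vector_derivative)
qed

text \<open>Only differences are used, so any antiderivative on the whole line serves.\<close>

definition owen_primitive :: "real \<Rightarrow> real" where
  "owen_primitive = (SOME H. \<forall>x. (H has_real_derivative owen_density x) (at x))"

lemma DERIV_owen_primitive: "(owen_primitive has_real_derivative owen_density x) (at x)"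
  unfolding owen_primitive_def using someI_ex[OF owen_antiderivative] by blast

text \<open>In terms of Owen's function this is \<open>T(1, \<beta>) - T(1, \<alpha>)\<close>;
  written with a primitive, it is visibly differentiable in both slopes and additive.\<close>

definition wedge_prob :: "real \<Rightarrow> real \<Rightarrow> real" where
  "wedge_prob \<alpha> \<beta> = owen_primitive \<beta> - owen_primitive \<alpha>"

lemma nn_integral_wedge_prob:
  assumes "\<alpha> \<le> \<beta>"
  shows "(\<integral>\<^sup>+x. \<integral>\<^sup>+y. indicator {(x, y). 1 < x \<and> \<alpha> * x < y \<and> y < \<beta> * x} (x, y)
      \<partial>std_normal_distribution \<partial>std_normal_distribution) = ennreal (wedge_prob \<alpha> \<beta>)"
  unfolding nn_integral_std_normal_wedge wedge_prob_def
  using assms DERIV_owen_primitive owen_density_pos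
  by (intro nn_integral_FTC_Icc) (auto intro: less_imp_le DERIV_subset)

text \<open>The lines of slopes \<open>t\<close> and \<open>- 1 / t\<close> are perpendicular, so a
  right angle is tilted against the edge \<open>x = 1\<close>, and the symmetric position
  \<open>t = 1\<close> captures most. Analytically, the two terms of the derivative share a
  denominator and differ by \<open>x\<^sup>2\<close> versus \<open>1 / x\<^sup>2\<close> in the
  exponent.\<close>

lemma wedge_prob_mono:
  assumes "0 < s" "s \<le> t" "t \<le> 1"
  shows "wedge_prob (- 1 / s) s \<le> wedge_prob (- 1 / t) t"
proof (rule DERIV_nonneg_imp_nondecreasing[OF assms(2)])
  fix x assume x: "s \<le> x" "x \<le> t"
  then have x0: "0 < x" "x \<le> 1" using assms by auto
  have "((\<lambda>t. - 1 / t) has_real_derivative 1 / x\<^sup>2) (at x)"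
    using x0 by (auto intro!: derivative_eq_intros simp: power2_eq_square)
  then have "((\<lambda>t. wedge_prob (- 1 / t) t) has_real_derivative owen_density x - owen_density (- 1 / x) * (1 / x\<^sup>2)) (at x)"
    unfolding wedge_prob_def
    by (intro derivative_intros DERIV_owen_primitive DERIV_chain2[of owen_primitive])
  moreover have "owen_density (- 1 / x) * (1 / x\<^sup>2) \<le> owen_density x"
  proof -
    have "x\<^sup>2 \<le> 1" using x0 by (simp add: power_le_one)
    then have "x\<^sup>2 * x\<^sup>2 \<le> 1" by (intro mult_le_one) auto
    then have "x\<^sup>2 \<le> 1 / x\<^sup>2" using x0 by (simp add: pos_le_divide_eq)
    then have "exp (- (1 + 1 / x\<^sup>2) / 2) \<le> exp (- (1 + x\<^sup>2) / 2)" by simp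
    moreover have "owen_density (- 1 / x) * (1 / x\<^sup>2) = exp (- (1 + 1 / x\<^sup>2) / 2) / (2 * pi * (1 + x\<^sup>2))"
      using x0 by (simp add: owen_density_def power_divide field_simps)
    ultimately show ?thesis
      unfolding owen_density_def using one_plus_square_pos[of x] by (simp add: divide_right_mono)
  qed
  ultimately show "\<exists>y. ((\<lambda>t. wedge_prob (- 1 / t) t) has_real_derivative y) (at x) \<and> 0 \<le> y"
    by (intro exI conjI) auto
qed

text \<open>The derivative of each error term is the error term of the preceding degree, so the
  signs follow in turn from \<open>1 + x \<le> exp x\<close>.\<close>

lemma exp_minus_taylor_bounds:
  fixes y :: real
  assumes "0 \<le> y"
  shows exp_minus_taylor_ge: "1 - y + y ^ 2 / 2 - y ^ 3 / 6 \<le> exp (- y)"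
    and exp_minus_taylor_le: "exp (- y) \<le> 1 - y + y ^ 2 / 2 - y ^ 3 / 6 + y ^ 4 / 24"
proof -
  have step: "g 0 \<le> g z" if "\<And>x. 0 \<le> x \<Longrightarrow> (g has_real_derivative g' x) (at x)" "\<And>x. 0 \<le> x \<Longrightarrow> 0 \<le> g' x" "0 \<le> z"
    for g g' :: "real \<Rightarrow> real" and z
    using that by (intro DERIV_nonneg_imp_nondecreasing[of 0 z g]) auto
  have 2: "exp (- z) \<le> 1 - z + z ^ 2 / 2" if z: "0 \<le> z" for z :: real
    using step[of "\<lambda>x. 1 - x + x ^ 2 / 2 - exp (- x)" "\<lambda>x. exp (- x) - (1 - x)" z]
      z exp_ge_add_one_self[of "- _"]
    by (fastforce intro!: derivative_eq_intros simp: field_simps)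
  have 3: "1 - z + z ^ 2 / 2 - z ^ 3 / 6 \<le> exp (- z)" if z: "0 \<le> z" for z :: real
  proof -
    have "exp (- 0) - (1 - 0 + 0 ^ 2 / 2 - 0 ^ 3 / 6) \<le> exp (- z) - (1 - z + z ^ 2 / 2 - z ^ 3 / 6)"
      by (rule step[where g'="\<lambda>x. (1 - x + x ^ 2 / 2) - exp (- x)", OF _ _ z])
         (use 2 in \<open>auto intro!: derivative_eq_intros simp: field_simps\<close>)
    then show ?thesis by simp
  qed
  have 4: "exp (- z) \<le> 1 - z + z ^ 2 / 2 - z ^ 3 / 6 + z ^ 4 / 24" if z: "0 \<le> z" for z :: real
  proof -
    have "(1 - 0 + 0 ^ 2 / 2 - 0 ^ 3 / 6 + 0 ^ 4 / 24) - exp (- 0) \<le> (1 - z + z ^ 2 / 2 - z ^ 3 / 6 + z ^ 4 / 24) - exp (- z)"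
      by (rule step[where g'="\<lambda>x. exp (- x) - (1 - x + x ^ 2 / 2 - x ^ 3 / 6)", OF _ _ z])
         (use 3 in \<open>auto intro!: derivative_eq_intros simp: field_simps\<close>)
    then show ?thesis by simp
  qed
  show "1 - y + y ^ 2 / 2 - y ^ 3 / 6 \<le> exp (- y)"
    "exp (- y) \<le> 1 - y + y ^ 2 / 2 - y ^ 3 / 6 + y ^ 4 / 24"
    using 3 4 assms by auto
qed

lemma wedge_prob_add: "wedge_prob \<alpha> \<beta> + wedge_prob \<beta> \<gamma> = wedge_prob \<alpha> \<gamma>"
  by (simp add: wedge_prob_def)

text \<open>In \<open>y = x\<^sup>2\<close>, the factor \<open>1 - 3 / 2 * y\<close> is the tangent
  at 0 of \<open>exp (- y / 2) / (1 + y)\<close>; \<open>12/125\<close> is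
  \<open>exp (- 1 / 2) / (2 * pi)\<close>, about 0.0965, rounded down.\<close>

lemma owen_density_ge:
  assumes "x\<^sup>2 \<le> 1"
  shows "12/125 * (1 - 3 / 2 * x\<^sup>2) \<le> owen_density x"
proof -
  define y where "y = x\<^sup>2"
  have y: "0 \<le> y" "y \<le> 1" using assms by (simp_all add: y_def)
  have c: "12/125 * (2 * pi) \<le> exp (- (1 / 2) :: real)"
  proof -
    have "12/125 * (2 * pi) \<le> 29/48" using pi_approx(2) by simp
    also have "\<dots> \<le> exp (- (1 / 2) :: real)"
      using exp_minus_taylor_ge[of "1/2"] by (simp add: eval_nat_numeral)
    finally show ?thesis .
  qed
  have "(1 - 3 / 2 * y) * (1 + y) \<le> 1 - y / 2"
    using y by (simp add: algebra_simps)
  also have "\<dots> \<le> exp (- (y / 2))" using exp_ge_add_one_self[of "- (y / 2)"] by simp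
  finally have e: "(1 - 3 / 2 * y) * (1 + y) \<le> exp (- (y / 2))" .
  have "12/125 * (1 - 3 / 2 * y) * (2 * pi * (1 + y)) = 12/125 * (2 * pi) * ((1 - 3 / 2 * y) * (1 + y))"
    by simp
  also have "\<dots> \<le> 12/125 * (2 * pi) * exp (- (y / 2))" using e by (intro mult_left_mono) auto
  also have "\<dots> \<le> exp (- (1 / 2)) * exp (- (y / 2))" using c by (intro mult_right_mono) auto
  also have "\<dots> = exp (- (1 + y) / 2)" by (simp add: exp_add[symmetric] add_divide_distrib)
  finally show ?thesis
    unfolding owen_density_def y_def[symmetric] using y by (subst pos_le_divide_eq) (auto intro!: mult_pos_pos)
qed

text \<open>The quadratic minorant is integrated from 0 to \<open>1/8\<close>:
  \<open>127/1024 = 1/8 - (1/8) ^ 3 / 2\<close>.\<close>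

lemma wedge_prob_eighth: "12/125 * (127/1024) \<le> wedge_prob 0 (1/8)"
proof -
  have "owen_primitive 0 - 12/125 * (0 - 0 ^ 3 / 2) \<le> owen_primitive (1/8) - 12/125 * (1/8 - (1/8) ^ 3 / 2)"
  proof (rule DERIV_nonneg_imp_nondecreasing[of 0 "1/8" "\<lambda>x. owen_primitive x - 12/125 * (x - x ^ 3 / 2)"])
    fix x :: real assume x: "0 \<le> x" "x \<le> 1/8"
    then have "x\<^sup>2 \<le> 1" by (simp add: power_le_one)
    then have "0 \<le> owen_density x - 12/125 * (1 - 3 / 2 * x\<^sup>2)" using owen_density_ge by simp
    moreover have "((\<lambda>x. owen_primitive x - 12/125 * (x - x ^ 3 / 2)) has_real_derivative
        owen_density x - 12/125 * (1 - 3 / 2 * x\<^sup>2)) (at x)"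
      by (auto intro!: derivative_eq_intros DERIV_owen_primitive)
    ultimately show "\<exists>y. ((\<lambda>x. owen_primitive x - 12/125 * (x - x ^ 3 / 2)) has_real_derivative y) (at x) \<and> 0 \<le> y"
      by blast
  qed simp
  then show ?thesis by (simp add: wedge_prob_def eval_nat_numeral)
qed

section \<open>Standard normal probabilities of intervals\<close>

lemma measure_std_normal_uminus:
  assumes [measurable]: "A \<in> sets borel"
  shows "measure std_normal_distribution {x. - x \<in> A} = measure std_normal_distribution A"
proof -
  have "emeasure std_normal_distribution A = (\<integral>\<^sup>+x. ennreal (std_normal_density x) * indicator A x \<partial>lborel)"
    by (simp add: emeasure_density)
  also have "\<dots> = (\<integral>\<^sup>+x. ennreal (std_normal_density x) * indicator {x. - x \<in> A} x \<partial>lborel)"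
    by (subst nn_integral_real_affine[where c="-1" and t=0])
       (auto simp: std_normal_density_def indicator_def intro!: nn_integral_cong)
  also have "\<dots> = emeasure std_normal_distribution {x. - x \<in> A}"
    by (simp add: emeasure_density)
  finally show ?thesis by (simp add: measure_def)
qed

lemma measure_std_normal_singleton: "measure std_normal_distribution {x} = 0"
  by (simp add: measure_def emeasure_density nn_integral_0_iff_AE AE_lborel_singleton[of x])

lemma measure_std_normal_atLeast_0: "measure std_normal_distribution {0..} = 1 / 2"
proof -
  interpret prob_space std_normal_distribution by (rule prob_space_std_normal)
  have "{x::real. - x \<in> {0..}} = {..0}" by auto
  then have 1: "prob {..0} = prob {0..}" using measure_std_normal_uminus[of "{0..}"] by simp
  have "prob {0..} + prob {..<0} = prob ({0..} \<union> {..<0})"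
    by (rule finite_measure_Union[symmetric]) auto
  also have "{0..} \<union> {..<0} = (UNIV :: real set)" by auto
  finally have 2: "prob {0..} + prob {..<0} = 1" using prob_space by simp
  have "prob ({..<0} \<union> {0}) = prob {..<0} + prob {0}"
    by (rule finite_measure_Union) auto
  also have "{..<0} \<union> {0} = {..(0::real)}" by auto
  finally have "prob {..0} = prob {..<0}" by (simp add: measure_std_normal_singleton)
  with 1 2 show ?thesis by simp
qed

lemma measure_std_normal_Icc_0_1: "measure std_normal_distribution {0..1} \<le> 34138 / 100000"
proof -
  \<comment> \<open>\<open>P\<close> bounds the exponential by its quartic Taylor polynomial at
    \<open>x\<^sup>2 / 2\<close> and rounds \<open>1 / sqrt (2 * pi)\<close> up; \<open>Q\<close> is
    its antiderivative.\<close>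
  define P where "P x = 39896/100000 * (1 - x ^ 2 / 2 + x ^ 4 / 8 - x ^ 6 / 48 + x ^ 8 / 384)" for x :: real
  define Q where "Q x = 39896/100000 * (x - x ^ 3 / 6 + x ^ 5 / 40 - x ^ 7 / 336 + x ^ 9 / 3456)" for x :: real
  have dens: "std_normal_density x \<le> P x" for x
  proof -
    have "2.5066 ^ 2 \<le> 2 * pi" using pi_approx(1) by (simp add: power2_eq_square)
    then have "2.5066 \<le> sqrt (2 * pi)" by (rule real_le_rsqrt)
    then have "1 / sqrt (2 * pi) \<le> 1 / 2.5066" by (intro divide_left_mono) auto
    also have "\<dots> \<le> 39896/100000" by simp
    finally show ?thesis
      unfolding std_normal_density_def P_def
      using exp_minus_taylor_le[of "x\<^sup>2 / 2"] by (intro mult_mono) (auto simp: power_divide simp flip: power_mult)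
  qed
  have P0: "0 \<le> P x" for x using dens[of x] normal_density_nonneg[of 0 1 x] by linarith
  have "emeasure std_normal_distribution {0..1}
      = (\<integral>\<^sup>+x. ennreal (std_normal_density x) * indicator {0..1} x \<partial>lborel)"
    by (simp add: emeasure_density)
  also have "\<dots> \<le> (\<integral>\<^sup>+x. ennreal (P x) * indicator {0..1} x \<partial>lborel)"
    by (intro nn_integral_mono mult_right_mono ennreal_leI dens) auto
  also have "\<dots> = ennreal (Q 1 - Q 0)"
  proof (rule nn_integral_FTC_Icc)
    show "P \<in> borel_measurable borel" unfolding P_def[abs_def] by measurable
    show "(Q has_real_derivative P x) (at x)" for x
      unfolding Q_def P_def
      by (rule derivative_eq_intros refl | simp)+
  qed (auto simp: P0)
  also have "\<dots> \<le> ennreal (34138 / 100000)" by (rule ennreal_leI) (simp add: Q_def)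
  finally show ?thesis
    by (simp only: finite_measure.emeasure_eq_measure[OF prob_space.finite_measure, OF prob_space_std_normal] ennreal_le_iff)
qed

lemma measure_std_normal_greaterThan_1: "15862/100000 \<le> measure std_normal_distribution {1<..}"
proof -
  interpret prob_space std_normal_distribution by (rule prob_space_std_normal)
  have "prob ({0..1} \<union> {1<..}) = prob {0..1} + prob {1<..}"
    by (rule finite_measure_Union) auto
  also have "{0..1} \<union> {1<..} = {(0::real)..}" by auto
  finally show ?thesis using measure_std_normal_atLeast_0 measure_std_normal_Icc_0_1 by simp
qed

text \<open>Markov's inequality for the sixth moment, \<open>15 = 5 * 3 * 1\<close>, keeps the loss
  below 0.00006, which the margin allows.\<close>

lemma measure_std_normal_Ico_minus_8_0: "1/2 - 15 / 8 ^ 6 \<le> measure std_normal_distribution {-8..<0}"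
proof -
  interpret prob_space std_normal_distribution by (rule prob_space_std_normal)
  have "prob {x \<in> space std_normal_distribution. 8 ^ 6 \<le> x ^ 6} \<le> (\<integral>x. x ^ 6 \<partial>std_normal_distribution) / 8 ^ 6"
    using std_normal_distribution_even_moments(2)[of 3]
    by (intro integral_Markov_inequality_measure[where A="{}"]) auto
  also have "(\<integral>x. x ^ 6 \<partial>std_normal_distribution) = 15"
    using std_normal_distribution_even_moments(1)[of 3] by (simp add: fact_numeral)
  finally have M: "prob {x. 8 ^ 6 \<le> x ^ 6} \<le> 15 / 8 ^ 6" by simp
  have "{..0} \<subseteq> {-8..<0} \<union> ({0} \<union> {x::real. 8 ^ 6 \<le> x ^ 6})"
  proof
    fix x :: real assume "x \<in> {..0}"
    moreover have "8 ^ 6 \<le> x ^ 6" if "x < -8"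
      using power_mono[of 8 "- x" 6] that by simp
    ultimately show "x \<in> {-8..<0} \<union> ({0} \<union> {x::real. 8 ^ 6 \<le> x ^ 6})"
      by (cases "x < -8"; cases "x = 0") auto
  qed
  then have "prob {..0} \<le> prob ({-8..<0} \<union> ({0} \<union> {x::real. 8 ^ 6 \<le> x ^ 6}))"
    by (intro finite_measure_mono) auto
  also have "\<dots> \<le> prob {-8..<0} + (prob {0} + prob {x::real. 8 ^ 6 \<le> x ^ 6})"
    using measure_Un_le[of "{-8..<0}" std_normal_distribution "{0} \<union> {x::real. 8 ^ 6 \<le> x ^ 6}"]
      measure_Un_le[of "{0}" std_normal_distribution "{x::real. 8 ^ 6 \<le> x ^ 6}"]
    by (simp only: sets_density sets_lborel) (simp del: insert_is_Un[symmetric] Un_insert_left)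
  also have "prob {..0} = 1/2"
  proof -
    have "{x::real. - x \<in> {0..}} = {..0}" by auto
    then show ?thesis using measure_std_normal_uminus[of "{0..}"] measure_std_normal_atLeast_0 by simp
  qed
  finally show ?thesis using M by (simp add: measure_std_normal_singleton)
qed

text \<open>
  By monotonicity only \<open>t = 1/8\<close> matters. There the wedge between \<open>y = -8 x\<close> and \<open>y = 0\<close> contains
  the product \<open>{1<..} \<times> {-8..<0}\<close>, which loses only the negligible mass below \<open>-8\<close>.
\<close>

lemma wedge_prob_lower_bound:
  assumes "1/8 \<le> t" "t \<le> 1"
  shows "0.0912 \<le> wedge_prob (- 1 / t) t"
proof -
  interpret prob_space std_normal_distribution by (rule prob_space_std_normal)
  have "ennreal (prob {1<..} * prob {-8..<0}) = emeasure std_normal_distribution {1<..} * emeasure std_normal_distribution {-8..<0}"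
    by (simp add: emeasure_eq_measure ennreal_mult)
  also have "\<dots> = (\<integral>\<^sup>+x. \<integral>\<^sup>+y. indicator {1<..} x * indicator {-8..<0} y \<partial>std_normal_distribution \<partial>std_normal_distribution)"
    by (simp add: nn_integral_cmult nn_integral_multc)
  also have "\<dots> \<le> (\<integral>\<^sup>+x. \<integral>\<^sup>+y. indicator {(x, y). 1 < x \<and> -8 * x < y \<and> y < 0 * x} (x, y)
      \<partial>std_normal_distribution \<partial>std_normal_distribution)"
    by (intro nn_integral_mono) (auto simp: indicator_def)
  also have "\<dots> = ennreal (wedge_prob (-8) 0)" by (rule nn_integral_wedge_prob) simp
  \<comment> \<open>Since \<open>ennreal\<close> sends negative reals to 0, returning to the reals
    requires the right-hand side to be nonnegative, which holds because the primitive is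
    increasing.\<close>
  finally have "prob {1<..} * prob {-8..<0} \<le> wedge_prob (-8) 0"
    using owen_density_pos DERIV_nonneg_imp_nondecreasing[of "-8" 0 owen_primitive] DERIV_owen_primitive
    by (subst (asm) ennreal_le_iff) (auto simp: wedge_prob_def intro: less_imp_le)
  \<comment> \<open>About 0.07930; with 0.01190 from the wedge between slopes 0 and
    \<open>1/8\<close> this just exceeds 0.0912.\<close>
  moreover have "15862/100000 * (1/2 - 15 / 8 ^ 6) \<le> prob {1<..} * prob {-8..<0}"
    by (intro mult_mono measure_std_normal_greaterThan_1 measure_std_normal_Ico_minus_8_0) simp_all
  moreover have "wedge_prob (-8) (1/8) = wedge_prob (-8) 0 + wedge_prob 0 (1/8)"
    by (simp add: wedge_prob_add)
  moreover have "wedge_prob (-8) (1/8) \<le> wedge_prob (- 1 / t) t"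
    using wedge_prob_mono[of "1/8" t] assms by simp
  ultimately show ?thesis using wedge_prob_eighth by simp
qed

text \<open>
  If \<open>r = cos \<theta>\<close> and \<open>c = sin \<theta>\<close>, then \<open>t = tan (\<theta> / 2)\<close>, and \<open>r = 63/65\<close> corresponds to \<open>t = 1/8\<close>.
\<close>

lemma half_angle_slope_bounds:
  fixes r c :: real
  assumes r: "0 \<le> r" "r \<le> 63/65" and c: "r\<^sup>2 + c\<^sup>2 = 1" and c0: "0 \<le> c"
  defines "t \<equiv> (1 - r) / c"
  shows "0 < c" "1/8 \<le> t" "t \<le> 1" "1 / t = (1 + r) / c"
proof -
  have "(1 - r) * (1 + r) = 1 - r\<^sup>2" by (simp add: power2_eq_square algebra_simps)
  then have c2: "c\<^sup>2 = (1 - r) * (1 + r)" using c by simp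
  then have "c \<noteq> 0" using r by auto
  then show cp: "0 < c" using c0 by simp
  have "(1 - r)\<^sup>2 \<le> c\<^sup>2" unfolding c2 using r by (simp only: power2_eq_square) (intro mult_left_mono, auto)
  then have "1 - r \<le> c" using c0 by (rule power2_le_imp_le)
  then show "t \<le> 1" using cp by (simp add: t_def)
  \<comment> \<open>Origin of \<open>63/65\<close>: the inequality
    \<open>1 + r \<le> 64 * (1 - r)\<close> says exactly \<open>r \<le> 63/65\<close>.\<close>
  have "(1 - r) * (1 + r) \<le> (1 - r) * (64 * (1 - r))" using r by (intro mult_left_mono) auto
  also have "(1 - r) * (64 * (1 - r)) = (8 * (1 - r))\<^sup>2" by algebra
  finally have "c\<^sup>2 \<le> (8 * (1 - r))\<^sup>2" unfolding c2 .
  then have "c \<le> 8 * (1 - r)" by (rule power2_le_imp_le) (use r in simp)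
  then show "1/8 \<le> t" using cp by (simp add: t_def field_simps)
  show "1 / t = (1 + r) / c"
    using c2 cp r by (simp add: t_def field_simps power2_eq_square)
qed

text \<open>
  The complement of the rhombus splits according to which of \<open>|x|\<close> and \<open>|r x + c y|\<close> is
  larger; the two halves are exchanged by a reflection, and each of them consists of two
  opposite wedges.
\<close>

lemma std_normal_rhombus_bound:
  fixes r c :: real
  assumes r: "0 \<le> r" "r \<le> 63/65" and c: "r\<^sup>2 + c\<^sup>2 = 1" "0 \<le> c"
  shows "(\<integral>\<^sup>+x. \<integral>\<^sup>+y. indicator {(x, y). \<bar>x\<bar> \<le> 1 \<and> \<bar>r * x + c * y\<bar> \<le> 1} (x, y)
      \<partial>std_normal_distribution \<partial>std_normal_distribution) \<le> ennreal (0.6355)"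
proof -
  interpret prob_space std_normal_distribution by (rule prob_space_std_normal)
  note g = half_angle_slope_bounds[OF r c]
  define t where "t = (1 - r) / c"
  have t: "1/8 \<le> t" "t \<le> 1" "1 / t = (1 + r) / c" using g by (simp_all add: t_def)
  let ?J = "\<lambda>S. \<integral>\<^sup>+x. \<integral>\<^sup>+y. indicator S (x, y) \<partial>std_normal_distribution \<partial>std_normal_distribution"
  let ?S = "{(x, y). \<bar>x\<bar> \<le> 1 \<and> \<bar>r * x + c * y\<bar> \<le> 1}"
  let ?A = "{(x, y). 1 < x \<and> \<bar>r * x + c * y\<bar> < x}"
  let ?A' = "{(x, y). x < - 1 \<and> \<bar>r * x + c * y\<bar> < - x}"
  let ?B = "{(x, y). 1 < r * x + c * y \<and> \<bar>x\<bar> < r * x + c * y}"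
  let ?B' = "{(x, y). r * x + c * y < - 1 \<and> \<bar>x\<bar> < - (r * x + c * y)}"
  have pred: "{p. P p} \<in> sets (borel \<Otimes>\<^sub>M borel)" if "Measurable.pred (borel \<Otimes>\<^sub>M borel) P" for P :: "real \<times> real \<Rightarrow> bool"
    using that by (simp add: pred_def space_pair_measure)
  have [measurable]: "?S \<in> sets (borel \<Otimes>\<^sub>M borel)" "?A \<in> sets (borel \<Otimes>\<^sub>M borel)" "?A' \<in> sets (borel \<Otimes>\<^sub>M borel)"
    "?B \<in> sets (borel \<Otimes>\<^sub>M borel)" "?B' \<in> sets (borel \<Otimes>\<^sub>M borel)"
    by (rule pred, measurable)+
  \<comment> \<open>On the lines of slopes \<open>t\<close> and \<open>- 1 / t\<close> the form
    \<open>r * x + c * y\<close> equals \<open>x\<close> and \<open>- x\<close>; these are the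
    diagonals of the rhombus.\<close>
  have "?A = {(x, y). 1 < x \<and> - 1 / t * x < y \<and> y < t * x}"
  proof -
    have "\<bar>r * x + c * y\<bar> < x \<longleftrightarrow> - 1 / t * x < y \<and> y < t * x" for x y
    proof -
      have "- 1 / t * x = - ((1 + r) * x / c)" using t(3) by (metis minus_divide_left mult_minus_left times_divide_eq_left)
      then have "- 1 / t * x < y \<longleftrightarrow> - x < r * x + c * y"
        using g(1) by (simp only: minus_less_iff[of _ y]) (simp add: less_divide_eq algebra_simps, linarith)
      moreover have "y < t * x \<longleftrightarrow> r * x + c * y < x"
        using g(1) by (simp add: t_def field_simps)
      ultimately show ?thesis by (auto simp: abs_less_iff)
    qed
    then show ?thesis by auto
  qed
  moreover have "- 1 / t \<le> t" proof -
    have "- 1 / t \<le> 0" using t(1) by simp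
    then show ?thesis using t(1) by linarith
  qed
  ultimately have JA: "?J ?A = ennreal (wedge_prob (- 1 / t) t)"
    by (simp only: nn_integral_wedge_prob)
  \<comment> \<open>The point reflection is composed of two axis reflections.\<close>
  have JA': "?J ?A' = ?J ?A"
  proof -
    have "?J ?A' = (\<integral>\<^sup>+x. \<integral>\<^sup>+y. indicator ?A' (- x, y) \<partial>std_normal_distribution \<partial>std_normal_distribution)"
      using std_normal_reflection[of "indicator ?A'" "-1" 0] by simp
    also have "\<dots> = (\<integral>\<^sup>+x. \<integral>\<^sup>+y. indicator ?A' (- x, - y) \<partial>std_normal_distribution \<partial>std_normal_distribution)"
      using std_normal_reflection[of "\<lambda>(x, y). indicator ?A' (- x, y)" 1 0] by simp
    also have "\<dots> = ?J ?A"
      by (intro nn_integral_cong) (auto simp: indicator_def)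
    finally show ?thesis .
  qed
  have refl: "r * (r * x + c * y) + c * (c * x - r * y) = x" for x y
  proof -
    have "r * (r * x + c * y) + c * (c * x - r * y) = (r\<^sup>2 + c\<^sup>2) * x" by algebra
    then show ?thesis using c by simp
  qed
  have JB: "?J ?B = ?J ?A"
    using std_normal_reflection[of "indicator ?A" r c] c
    by (simp add: indicator_def refl)
  have JB': "?J ?B' = ?J ?A'"
    using std_normal_reflection[of "indicator ?A'" r c] c
    by (simp add: indicator_def refl)
  have "?J ?S + (?J ?A + (?J ?A' + (?J ?B + ?J ?B')))
     = (\<integral>\<^sup>+x. \<integral>\<^sup>+y. indicator ?S (x, y) + (indicator ?A (x, y) + (indicator ?A' (x, y) + (indicator ?B (x, y) + indicator ?B' (x, y))))
      \<partial>std_normal_distribution \<partial>std_normal_distribution)"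
    by (simp add: nn_integral_add)
  \<comment> \<open>The strict inequalities make the five sets pairwise disjoint, so their
    indicators sum to at most 1.\<close>
  also have "\<dots> \<le> (\<integral>\<^sup>+x. \<integral>\<^sup>+y. 1 \<partial>std_normal_distribution \<partial>std_normal_distribution)"
    by (intro nn_integral_mono) (auto simp: indicator_def abs_le_iff abs_less_iff)
  also have "\<dots> = 1" by (simp add: emeasure_space_1[simplified])
  finally have tot: "?J ?S + ennreal (4 * wedge_prob (- 1 / t) t) \<le> 1"
  proof -
    assume *: "?J ?S + (?J ?A + (?J ?A' + (?J ?B + ?J ?B'))) \<le> 1"
    have "0 \<le> wedge_prob (- 1 / t) t" using wedge_prob_lower_bound[OF t(1,2)] by simp
    then show ?thesis using *
      unfolding JB' JB JA' JA by (simp add: ennreal_plus[symmetric] del: ennreal_plus)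
  qed
  \<comment> \<open>\<open>4 * 0.0912 = 0.3648\<close>, and
    \<open>1 - 0.3645 = 0.6355\<close>.\<close>
  have "?J ?S + ennreal 0.3645 \<le> ?J ?S + ennreal (4 * wedge_prob (- 1 / t) t)"
    using wedge_prob_lower_bound[OF t(1,2)] by (intro add_left_mono ennreal_leI) simp
  also note tot
  also have "1 = ennreal (0.6355) + ennreal 0.3645" by (simp add: ennreal_plus[symmetric] del: ennreal_plus)
  finally show ?thesis by simp
qed

section \<open>Independent rows\<close>

text \<open>Independence of events that depend on disjoint blocks of coordinates. The index set
  grows with \<open>M\<close>, so the induction splits off the last block by Fubini, and the
  indicator of the merged point factorises by \<open>local\<close>.\<close>

lemma emeasure_PiM_disjoint_blocks:
  fixes N :: "'a measure" and J :: "nat \<Rightarrow> 'i set" and P :: "nat \<Rightarrow> ('i \<Rightarrow> 'a) \<Rightarrow> bool"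
  assumes N: "prob_space N" and fin: "\<And>r. finite (J r)" and disj: "\<And>r s. r \<noteq> s \<Longrightarrow> J r \<inter> J s = {}"
    and local: "\<And>r \<omega> \<omega>'. (\<And>j. j \<in> J r \<Longrightarrow> \<omega> j = \<omega>' j) \<Longrightarrow> P r \<omega> \<longleftrightarrow> P r \<omega>'"
    and meas: "\<And>r. {\<omega> \<in> space (\<Pi>\<^sub>M _\<in>J r. N). P r \<omega>} \<in> sets (\<Pi>\<^sub>M _\<in>J r. N)"
    and le: "\<And>r. emeasure (\<Pi>\<^sub>M _\<in>J r. N) {\<omega> \<in> space (\<Pi>\<^sub>M _\<in>J r. N). P r \<omega>} \<le> q"
  defines "E \<equiv> \<lambda>M. {\<omega> \<in> space (\<Pi>\<^sub>M _\<in>(\<Union>r<M. J r). N). \<forall>r<M. P r \<omega>}"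
  shows "E M \<in> sets (\<Pi>\<^sub>M _\<in>(\<Union>r<M. J r). N)"
    and "emeasure (\<Pi>\<^sub>M _\<in>(\<Union>r<M. J r). N) (E M) \<le> q ^ M"
proof -
  interpret N: prob_space N by (rule N)
  interpret product_sigma_finite "\<lambda>_::'i. N" ..
  have sets: "E M \<in> sets (\<Pi>\<^sub>M _\<in>(\<Union>r<M. J r). N)" for M
  proof -
    have "{\<omega> \<in> space (\<Pi>\<^sub>M _\<in>(\<Union>r<M. J r). N). P r \<omega>} \<in> sets (\<Pi>\<^sub>M _\<in>(\<Union>r<M. J r). N)" if "r < M" for r
    proof -
      have sub: "J r \<subseteq> (\<Union>r<M. J r)" using that by auto
      have "{\<omega> \<in> space (\<Pi>\<^sub>M _\<in>(\<Union>r<M. J r). N). P r \<omega>}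
        = (\<lambda>\<omega>. restrict \<omega> (J r)) -` {\<omega> \<in> space (\<Pi>\<^sub>M _\<in>J r. N). P r \<omega>} \<inter> space (\<Pi>\<^sub>M _\<in>(\<Union>r<M. J r). N)"
        using local[of r "restrict _ (J r)"] measurable_space[OF measurable_restrict_subset[OF sub, of "\<lambda>_. N"]]
        by auto
      also have "\<dots> \<in> sets (\<Pi>\<^sub>M _\<in>(\<Union>r<M. J r). N)"
        using measurable_restrict_subset[OF sub, of "\<lambda>_. N"] meas[of r] by (rule measurable_sets)
      finally show ?thesis .
    qed
    note s = this
    show ?thesis
    proof (cases "M = 0")
      case True
      then have "E M = space (\<Pi>\<^sub>M _\<in>(\<Union>r<M. J r). N)" by (simp add: E_def)
      then show ?thesis by (metis sets.top)
    next
      case False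
      have "{\<omega> \<in> space (\<Pi>\<^sub>M _\<in>(\<Union>r<M. J r). N). \<forall>r\<in>{..<M}. P r \<omega>} \<in> sets (\<Pi>\<^sub>M _\<in>(\<Union>r<M. J r). N)"
      proof (rule sets.sets_Collect_finite_All')
        show "{\<omega> \<in> space (\<Pi>\<^sub>M _\<in>(\<Union>r<M. J r). N). P i \<omega>} \<in> sets (\<Pi>\<^sub>M _\<in>(\<Union>r<M. J r). N)" if "i \<in> {..<M}" for i
          using that s[of i] by (simp only: lessThan_iff)
        show "finite {..<M}" by simp
        show "{..<M} \<noteq> {}" using False by auto
      qed
      then show ?thesis unfolding E_def by (simp only: lessThan_iff Ball_def)
    qed
  qed
  show "E M \<in> sets (\<Pi>\<^sub>M _\<in>(\<Union>r<M. J r). N)" by (rule sets)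
  show "emeasure (\<Pi>\<^sub>M _\<in>(\<Union>r<M. J r). N) (E M) \<le> q ^ M"
  proof (induction M)
    case 0
    show ?case by (simp add: E_def PiM_empty)
  next
    case (Suc M)
    define K where "K = (\<Union>r<M. J r)"
    have "J r \<inter> J M = {}" if "r < M" for r using disj[of r M] that by simp
    then have K: "K \<inter> J M = {}" unfolding K_def by blast
    have finK: "finite K" using fin by (simp add: K_def)
    have U: "(\<Union>r<Suc M. J r) = K \<union> J M" unfolding K_def by (auto simp: less_Suc_eq)
    define F where "F = {\<omega> \<in> space (\<Pi>\<^sub>M _\<in>J M. N). P M \<omega>}"
    have EM: "E M \<in> sets (\<Pi>\<^sub>M _\<in>K. N)" and FM: "F \<in> sets (\<Pi>\<^sub>M _\<in>J M. N)"
      using sets[of M] meas[of M] by (simp_all add: K_def F_def)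
    have ES: "E (Suc M) \<in> sets (\<Pi>\<^sub>M _\<in>K \<union> J M. N)" using sets[of "Suc M"] unfolding U .
    have ind: "indicator (E (Suc M)) (merge K (J M) (x, y)) = (indicator (E M) x * indicator F y :: ennreal)"
      if x: "x \<in> space (\<Pi>\<^sub>M _\<in>K. N)" and y: "y \<in> space (\<Pi>\<^sub>M _\<in>J M. N)" for x y
    proof -
      have "merge K (J M) (x, y) \<in> space (\<Pi>\<^sub>M _\<in>K \<union> J M. N)"
        using x y by (auto simp: space_PiM PiE_iff merge_def extensional_def)
      moreover have "P r (merge K (J M) (x, y)) \<longleftrightarrow> P r x" if "r < M" for r
        by (rule local) (use that in \<open>auto simp: merge_def K_def\<close>)
      moreover have "P M (merge K (J M) (x, y)) \<longleftrightarrow> P M y"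
        by (rule local) (use K in \<open>auto simp: merge_def\<close>)
      ultimately have "merge K (J M) (x, y) \<in> E (Suc M) \<longleftrightarrow> x \<in> E M \<and> y \<in> F"
        using x y unfolding E_def U F_def K_def[symmetric] by (auto simp: less_Suc_eq)
      then show ?thesis by (simp add: indicator_def)
    qed
    have "emeasure (\<Pi>\<^sub>M _\<in>(\<Union>r<Suc M. J r). N) (E (Suc M))
        = (\<integral>\<^sup>+\<omega>. indicator (E (Suc M)) \<omega> \<partial>(\<Pi>\<^sub>M _\<in>K \<union> J M. N))"
      using ES unfolding U by simp
    also have "\<dots> = (\<integral>\<^sup>+x. \<integral>\<^sup>+y. indicator (E (Suc M)) (merge K (J M) (x, y)) \<partial>(\<Pi>\<^sub>M _\<in>J M. N) \<partial>(\<Pi>\<^sub>M _\<in>K. N))"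
      using ES by (intro product_nn_integral_fold K finK fin) simp
    also have "\<dots> = (\<integral>\<^sup>+x. \<integral>\<^sup>+y. indicator (E M) x * indicator F y \<partial>(\<Pi>\<^sub>M _\<in>J M. N) \<partial>(\<Pi>\<^sub>M _\<in>K. N))"
      by (intro nn_integral_cong ind)
    also have "\<dots> = emeasure (\<Pi>\<^sub>M _\<in>K. N) (E M) * emeasure (\<Pi>\<^sub>M _\<in>J M. N) F"
      using EM FM by (simp add: nn_integral_cmult nn_integral_multc)
    also have "\<dots> \<le> q ^ M * q"
      using Suc.IH le[of M] unfolding K_def F_def by (intro mult_mono) auto
    finally show ?case by (simp add: mult.commute)
  qed
qed

text \<open>Unit length of \<open>u\<close> forces \<open>a = 1\<close>, so \<open>b\<close> is the
  correlation and \<open>b\<^sup>2 + c\<^sup>2 = 1\<close>: the two strips become the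
  rhombus.\<close>

lemma std_normal_PiM_two_strips:
  fixes u v :: "'i \<Rightarrow> real"
  assumes J: "finite J" and u: "(\<Sum>j\<in>J. (u j)\<^sup>2) = 1" and v: "(\<Sum>j\<in>J. (v j)\<^sup>2) = 1"
    and uv: "0 \<le> (\<Sum>j\<in>J. u j * v j)" "(\<Sum>j\<in>J. u j * v j) \<le> 63/65"
  defines "\<mu> \<equiv> \<Pi>\<^sub>M _\<in>J. std_normal_distribution"
  defines "S \<equiv> {\<omega> \<in> space \<mu>. \<bar>\<Sum>j\<in>J. u j * \<omega> j\<bar> \<le> 1 \<and> \<bar>\<Sum>j\<in>J. v j * \<omega> j\<bar> \<le> 1}"
  shows "S \<in> sets \<mu>" and "emeasure \<mu> S \<le> ennreal 0.6355"
proof -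
  show S: "S \<in> sets \<mu>" unfolding S_def \<mu>_def by measurable
  obtain a b c where abc: "0 \<le> a" "0 \<le> c" "a\<^sup>2 = (\<Sum>j\<in>J. (u j)\<^sup>2)" "a * b = (\<Sum>j\<in>J. u j * v j)"
    "b\<^sup>2 + c\<^sup>2 = (\<Sum>j\<in>J. (v j)\<^sup>2)"
    and law: "\<And>f :: real \<times> real \<Rightarrow> ennreal. f \<in> borel_measurable (borel \<Otimes>\<^sub>M borel) \<Longrightarrow>
      (\<integral>\<^sup>+\<omega>. f (\<Sum>j\<in>J. u j * \<omega> j, \<Sum>j\<in>J. v j * \<omega> j) \<partial>\<mu>)
      = (\<integral>\<^sup>+x. \<integral>\<^sup>+y. f (a * x, b * x + c * y) \<partial>std_normal_distribution \<partial>std_normal_distribution)"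
    using std_normal_PiM_linear_pair[OF J, of u v] unfolding \<mu>_def by blast
  have a: "a = 1" using abc(1,3) u by (simp add: power2_eq_1_iff)
  define Q where "Q = {p :: real \<times> real. \<bar>fst p\<bar> \<le> 1 \<and> \<bar>snd p\<bar> \<le> 1}"
  have Q: "Q \<in> sets (borel \<Otimes>\<^sub>M borel)"
    unfolding Q_def borel_prod by (intro borel_closed closed_Collect_conj closed_Collect_le continuous_intros)
  have "emeasure \<mu> S = (\<integral>\<^sup>+\<omega>. indicator S \<omega> \<partial>\<mu>)" using S by simp
  also have "\<dots> = (\<integral>\<^sup>+\<omega>. indicator Q (\<Sum>j\<in>J. u j * \<omega> j, \<Sum>j\<in>J. v j * \<omega> j) \<partial>\<mu>)"
    by (intro nn_integral_cong) (simp add: S_def Q_def indicator_def)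
  also have "\<dots> = (\<integral>\<^sup>+x. \<integral>\<^sup>+y. indicator Q (a * x, b * x + c * y) \<partial>std_normal_distribution \<partial>std_normal_distribution)"
    using Q by (intro law) simp
  also have "\<dots> = (\<integral>\<^sup>+x. \<integral>\<^sup>+y. indicator {(x, y). \<bar>x\<bar> \<le> 1 \<and> \<bar>b * x + c * y\<bar> \<le> 1} (x, y)
      \<partial>std_normal_distribution \<partial>std_normal_distribution)"
    by (simp add: Q_def a indicator_def)
  also have "\<dots> \<le> ennreal 0.6355"
    using abc a u v uv by (intro std_normal_rhombus_bound) auto
  finally show "emeasure \<mu> S \<le> ennreal 0.6355" .
qed

section \<open>The first moment\<close>

text \<open>
  Chernoff bound: a disagreement is given the weight \<open>1/63 = x / (1 - x)\<close>, which is optimal for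
  the fraction \<open>x = 1/64\<close> of disagreements.
\<close>

lemma count_close_sign_vectors:
  assumes \<sigma>: "\<sigma> \<in> cube n"
  shows "real (card {\<tau> \<in> cube n. 31/32 * real n \<le> inner_n n \<sigma> \<tau>}) \<le> (64/63) ^ n * 63 powr (real n / 64)"
proof -
  have fin: "finite (cube n)" unfolding cube_def by (intro finite_PiE) auto
  have pm: "\<sigma> k = 1 \<or> \<sigma> k = -1" if "k < n" for k using \<sigma> that by (auto simp: cube_def PiE_iff)
  \<comment> \<open>The weight is 1 for an agreement and \<open>1/63\<close> for a disagreement. As
    \<open>n\<close> minus the inner product is twice the number of disagreements, the threshold
    \<open>31/32\<close> allows at most \<open>n / 64\<close> of them.\<close>
  define w where "w k s = 63 powr ((\<sigma> k * s - 1) / 2)" for k and s :: real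
  have w: "(\<Prod>k<n. w k (\<tau> k)) = 63 powr ((inner_n n \<sigma> \<tau> - real n) / 2)" for \<tau>
    by (simp add: w_def powr_sum[symmetric] inner_n_def sum_divide_distrib[symmetric] sum_subtractf)
  have "real (card {\<tau> \<in> cube n. 31/32 * real n \<le> inner_n n \<sigma> \<tau>})
      = (\<Sum>\<tau>\<in>{\<tau> \<in> cube n. 31/32 * real n \<le> inner_n n \<sigma> \<tau>}. 1)" by simp
  also have "\<dots> \<le> (\<Sum>\<tau>\<in>{\<tau> \<in> cube n. 31/32 * real n \<le> inner_n n \<sigma> \<tau>}. 63 powr (real n / 64) * (\<Prod>k<n. w k (\<tau> k)))"
    unfolding w powr_add[symmetric] by (intro sum_mono ge_one_powr_ge_zero) (auto simp: field_simps)
  also have "\<dots> \<le> (\<Sum>\<tau>\<in>cube n. 63 powr (real n / 64) * (\<Prod>k<n. w k (\<tau> k)))"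
    using fin by (intro sum_mono2) (auto simp: w)
  also have "\<dots> = 63 powr (real n / 64) * (\<Prod>k<n. \<Sum>s\<in>{-1, 1}. w k s)"
    by (subst prod_sum_PiE) (simp_all add: cube_def sum_distrib_left)
  also have "(\<Prod>k<n. \<Sum>s\<in>{-1, 1}. w k s) = (\<Prod>k<n. 64/63)"
  proof (rule prod.cong)
    fix k assume "k \<in> {..<n}"
    with pm[of k] show "(\<Sum>s\<in>{-1, 1}. w k s) = 64/63" by (auto simp: w_def powr_minus)
  qed simp
  finally show ?thesis by (simp add: mult.commute)
qed

section \<open>Numerical verification of the exponential rate\<close>

lemma powr_le_of_power_le:
  fixes x y :: real
  assumes "0 < x" "0 < y" "0 < b" "x ^ a \<le> y ^ b"
  shows "x powr (real a / real b) \<le> y"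
proof -
  have "x powr (real a / real b) = (x ^ a) powr (1 / real b)"
    using assms by (simp add: powr_powr flip: powr_realpow)
  also have "\<dots> \<le> (y ^ b) powr (1 / real b)"
    using assms by (intro powr_mono2) auto
  also have "\<dots> = y" using assms by (simp add: powr_powr flip: powr_realpow)
  finally show ?thesis .
qed

text \<open>With \<open>1.71 = 171 / 100\<close> both estimates become comparisons of integer
  powers. The exponents \<open>8 * 8\<close>, \<open>9 * 19\<close> and \<open>10 * 10\<close> are
  reached in stages with rounding in between, which keeps the rationals small.\<close>

lemma exponential_rate_less_one: "2 * (64/63) * 63 powr (1/64) * 0.6355 powr 1.71 < (1::real)"
proof -
  have "63 powr (1/64) \<le> (1.0669::real)"
  proof -
    have "(63::real) ^ 1 \<le> 1.6787 ^ 8" by (simp add: eval_nat_numeral)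
    also have "\<dots> \<le> (1.0669 ^ 8) ^ 8" by (intro power_mono) (simp_all add: eval_nat_numeral)
    also have "\<dots> = 1.0669 ^ (8 * 8)" by (rule power_mult[symmetric])
    finally show ?thesis using powr_le_of_power_le[of 63 "1.0669" "8 * 8" 1] by simp
  qed
  moreover have "0.6355 powr 1.71 \<le> (0.461::real)"
  proof -
    have "(0.6355::real) ^ (9 * 19) = (0.6355 ^ 9) ^ 19" by (rule power_mult)
    also have "\<dots> \<le> 0.01692 ^ 19" by (intro power_mono) (simp_all add: eval_nat_numeral)
    also have "\<dots> \<le> (0.000433 ^ 10 :: real)" by (simp add: eval_nat_numeral)
    also have "\<dots> \<le> (0.461 ^ 10) ^ 10" by (intro power_mono) (simp_all add: eval_nat_numeral)
    also have "\<dots> = 0.461 ^ (10 * 10)" by (rule power_mult[symmetric])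
    finally show ?thesis using powr_le_of_power_le[of "0.6355" "0.461" "10 * 10" "9 * 19"] by simp
  qed
  ultimately have "2 * (64/63) * 63 powr (1/64) * 0.6355 powr 1.71 \<le> 2 * (64/63) * 1.0669 * (0.461::real)"
    by (intro mult_mono) auto
  then show ?thesis by simp
qed

section \<open>Rows of the interpolated matrices as linear forms\<close>

definition row_block :: "nat \<Rightarrow> nat \<Rightarrow> (nat \<times> nat \<times> nat) set" where
  "row_block n r = {0..2} \<times> {r} \<times> {..<n}"

text \<open>Division by \<open>sqrt (real n)\<close> makes this a unit vector for \<sigma> in the
  cube, so the constraint on each row is a strip of half-width 1. The coefficients are the same in
  every row.\<close>

definition row_coeff :: "nat \<Rightarrow> nat \<Rightarrow> real \<Rightarrow> (nat \<Rightarrow> real) \<Rightarrow> nat \<times> nat \<times> nat \<Rightarrow> real" where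
  "row_coeff n i \<tau> \<sigma> = (\<lambda>(l, r, k). (if l = 0 then cos \<tau> else if l = i then sin \<tau> else 0) * \<sigma> k / sqrt (real n))"

lemma sum_row_block: "(\<Sum>j\<in>row_block n r. f j) = (\<Sum>k<n. f (0, r, k)) + (\<Sum>k<n. f (1, r, k)) + (\<Sum>k<n. f (2, r, k))"
proof -
  have "{0..2} = {0, 1, 2 :: nat}" by auto
  moreover have "(\<Sum>j\<in>row_block n r. f j) = (\<Sum>i\<in>{0..2}. \<Sum>s\<in>{r}. \<Sum>k<n. f (i, s, k))"
    by (simp only: row_block_def sum.cartesian_product')
  ultimately show ?thesis by (simp add: add.assoc)
qed

lemma sum_row_coeff:
  assumes "i = 1 \<or> i = 2"
  shows "(\<Sum>j\<in>row_block n r. row_coeff n i \<tau> \<sigma> j * \<omega> j)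
    = mat_vec n (interpolated_matrix \<omega> i \<tau>) \<sigma> r / sqrt (real n)"
  using assms
  by (auto simp: sum_row_block row_coeff_def mat_vec_def inner_n_def interpolated_matrix_def sum.distrib[symmetric]
      sum_divide_distrib algebra_simps add_divide_distrib intro!: sum.cong)

lemma inner_n_cube:
  assumes "\<sigma> \<in> cube n"
  shows "inner_n n \<sigma> \<sigma> = real n"
proof -
  have "\<sigma> k = -1 \<or> \<sigma> k = 1" if "k < n" for k
    using assms that by (auto simp: cube_def PiE_iff)
  then have "\<sigma> k * \<sigma> k = 1" if "k < n" for k
    using that by force
  then show ?thesis by (simp add: inner_n_def)
qed

lemma sum_row_coeff_square:
  assumes "i = 1 \<or> i = 2" "\<sigma> \<in> cube n" "0 < n"
  shows "(\<Sum>j\<in>row_block n r. (row_coeff n i \<tau> \<sigma> j)\<^sup>2) = 1"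
proof -
  have "(\<Sum>j\<in>row_block n r. (row_coeff n i \<tau> \<sigma> j)\<^sup>2) = ((cos \<tau>)\<^sup>2 + (sin \<tau>)\<^sup>2) * (inner_n n \<sigma> \<sigma> / real n)"
    using assms(1)
    by (auto simp: sum_row_block row_coeff_def inner_n_def power_mult_distrib power_divide sum_divide_distrib
        sum_distrib_left power2_eq_square[of "\<sigma> _"] distrib_right sum.distrib add_divide_distrib simp del: sin_cos_squared_add sin_cos_squared_add2)
  then show ?thesis using assms by (simp add: inner_n_cube)
qed

text \<open>Only the matrix with index 0 is common to the two forms; the sine parts have disjoint
  supports.\<close>

lemma sum_row_coeff_mult:
  assumes "0 < n"
  shows "(\<Sum>j\<in>row_block n r. row_coeff n 1 \<tau>\<^sub>1 \<sigma>\<^sub>1 j * row_coeff n 2 \<tau>\<^sub>2 \<sigma>\<^sub>2 j)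
    = cos \<tau>\<^sub>1 * cos \<tau>\<^sub>2 * (inner_n n \<sigma>\<^sub>1 \<sigma>\<^sub>2 / real n)"
  using assms
  by (simp add: sum_row_block row_coeff_def inner_n_def sum_divide_distrib sum_distrib_left mult_ac)

section \<open>The probability for a fixed pair and fixed angles\<close>

lemma linf_norm_le_iff:
  assumes "0 \<le> B"
  shows "linf_norm M w \<le> B \<longleftrightarrow> (\<forall>r<M. \<bar>w r\<bar> \<le> B)"
  using assms by (auto simp: linf_norm_def)

definition pair_event :: "nat \<Rightarrow> nat \<Rightarrow> (nat \<Rightarrow> real) \<Rightarrow> (nat \<Rightarrow> real) \<Rightarrow> real \<Rightarrow> real \<Rightarrow> (nat \<times> nat \<times> nat \<Rightarrow> real) set" where
  "pair_event n M \<sigma>\<^sub>1 \<sigma>\<^sub>2 \<tau>\<^sub>1 \<tau>\<^sub>2 = {\<omega> \<in> space (gaussian_matrices 2 M n).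
     linf_norm M (mat_vec n (interpolated_matrix \<omega> 1 \<tau>\<^sub>1) \<sigma>\<^sub>1) \<le> sqrt (real n) \<and>
     linf_norm M (mat_vec n (interpolated_matrix \<omega> 2 \<tau>\<^sub>2) \<sigma>\<^sub>2) \<le> sqrt (real n)}"

lemma pair_event_bound:
  assumes n: "0 < n" and \<sigma>: "\<sigma>\<^sub>1 \<in> cube n" "\<sigma>\<^sub>2 \<in> cube n" and \<tau>: "\<tau>\<^sub>1 \<in> {0..pi/2}" "\<tau>\<^sub>2 \<in> {0..pi/2}"
    and ov: "0 \<le> inner_n n \<sigma>\<^sub>1 \<sigma>\<^sub>2 / real n" "inner_n n \<sigma>\<^sub>1 \<sigma>\<^sub>2 / real n \<le> 63/65"
  shows "pair_event n M \<sigma>\<^sub>1 \<sigma>\<^sub>2 \<tau>\<^sub>1 \<tau>\<^sub>2 \<in> sets (gaussian_matrices 2 M n)"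
    and "measure (gaussian_matrices 2 M n) (pair_event n M \<sigma>\<^sub>1 \<sigma>\<^sub>2 \<tau>\<^sub>1 \<tau>\<^sub>2) \<le> 0.6355 ^ M"
proof -
  define u where "u = row_coeff n 1 \<tau>\<^sub>1 \<sigma>\<^sub>1"
  define v where "v = row_coeff n 2 \<tau>\<^sub>2 \<sigma>\<^sub>2"
  define P where "P r \<omega> \<longleftrightarrow> \<bar>\<Sum>j\<in>row_block n r. u j * \<omega> j\<bar> \<le> 1 \<and> \<bar>\<Sum>j\<in>row_block n r. v j * \<omega> j\<bar> \<le> 1" for r \<omega>
  have U: "{0..2} \<times> {..<M} \<times> {..<n} = (\<Union>r<M. row_block n r)" by (auto simp: row_block_def)
  have fin: "finite (row_block n r)" for r by (simp add: row_block_def)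
  have disj: "r \<noteq> s \<Longrightarrow> row_block n r \<inter> row_block n s = {}" for r s by (auto simp: row_block_def)
  \<comment> \<open>The range \<open>[0, pi/2]\<close> of the angles enters here: it prevents a
    negative correlation.\<close>
  have cos: "0 \<le> cos \<tau>\<^sub>1 * cos \<tau>\<^sub>2" "cos \<tau>\<^sub>1 * cos \<tau>\<^sub>2 \<le> 1"
    using \<tau> by (auto intro!: mult_nonneg_nonneg mult_le_one cos_ge_zero)
  have uv: "0 \<le> (\<Sum>j\<in>row_block n r. u j * v j)" "(\<Sum>j\<in>row_block n r. u j * v j) \<le> 63/65" for r
    unfolding u_def v_def sum_row_coeff_mult[OF n]
    using mult_nonneg_nonneg[OF cos(1) ov(1)] mult_mono[OF cos(2) ov(2) _ ov(1)] by simp_all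
  have "(\<Sum>j\<in>row_block n r. (u j)\<^sup>2) = 1" "(\<Sum>j\<in>row_block n r. (v j)\<^sup>2) = 1" for r
    using \<sigma> n unfolding u_def v_def by (simp_all add: sum_row_coeff_square)
  note strips = std_normal_PiM_two_strips[OF fin this uv]
  have E: "pair_event n M \<sigma>\<^sub>1 \<sigma>\<^sub>2 \<tau>\<^sub>1 \<tau>\<^sub>2
      = {\<omega> \<in> space (\<Pi>\<^sub>M _\<in>(\<Union>r<M. row_block n r). std_normal_distribution). \<forall>r<M. P r \<omega>}"
    using n
    by (auto simp: pair_event_def gaussian_matrices_def U linf_norm_le_iff P_def u_def v_def sum_row_coeff abs_div)
  have blocks: "\<And>r \<omega> \<omega>'. (\<And>j. j \<in> row_block n r \<Longrightarrow> \<omega> j = \<omega>' j) \<Longrightarrow> P r \<omega> \<longleftrightarrow> P r \<omega>'"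
    "\<And>r. {\<omega> \<in> space (\<Pi>\<^sub>M _\<in>row_block n r. std_normal_distribution). P r \<omega>} \<in> sets (\<Pi>\<^sub>M _\<in>row_block n r. std_normal_distribution)"
    "\<And>r. emeasure (\<Pi>\<^sub>M _\<in>row_block n r. std_normal_distribution)
       {\<omega> \<in> space (\<Pi>\<^sub>M _\<in>row_block n r. std_normal_distribution). P r \<omega>} \<le> ennreal 0.6355"
    unfolding P_def using strips \<sigma> n by (simp_all cong: sum.cong)
  note block_bound = emeasure_PiM_disjoint_blocks[OF prob_space_std_normal fin disj blocks]
  show "pair_event n M \<sigma>\<^sub>1 \<sigma>\<^sub>2 \<tau>\<^sub>1 \<tau>\<^sub>2 \<in> sets (gaussian_matrices 2 M n)"
    unfolding E gaussian_matrices_def U by (rule block_bound(1))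
  have "emeasure (gaussian_matrices 2 M n) (pair_event n M \<sigma>\<^sub>1 \<sigma>\<^sub>2 \<tau>\<^sub>1 \<tau>\<^sub>2) \<le> ennreal 0.6355 ^ M"
    unfolding E gaussian_matrices_def U by (rule block_bound(2))
  also have "\<dots> = ennreal (0.6355 ^ M)" by (rule ennreal_power) simp
  finally show "measure (gaussian_matrices 2 M n) (pair_event n M \<sigma>\<^sub>1 \<sigma>\<^sub>2 \<tau>\<^sub>1 \<tau>\<^sub>2) \<le> 0.6355 ^ M"
    unfolding measure_def by (rule enn2real_leI[rotated]) simp
qed

text \<open>
  Here \<open>63/65 - 1/2080 = 31/32\<close>, so the two sign vectors differ in at most \<open>n / 64\<close> coordinates.
\<close>

lemma prob_overlap_set_nonempty_le:
  assumes n: "0 < n" and I: "I \<subseteq> {0..pi / 2}" "finite I"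
  shows "prob_overlap_set_nonempty (63/65) (1/2080) 2 \<alpha> I n
    \<le> 2 ^ n * ((64/63) ^ n * 63 powr (real n / 64)) * (real (card I))\<^sup>2 * 0.6355 ^ num_constraints \<alpha> n"
proof -
  define M where "M = num_constraints \<alpha> n"
  define \<mu> where "\<mu> = gaussian_matrices 2 M n"
  define G where "G = (SIGMA \<sigma>:cube n. {\<tau> \<in> cube n. 31/32 * real n \<le> inner_n n \<sigma> \<tau>})"
  \<comment> \<open>\<open>G\<close> carries only the lower overlap bound, which the counting uses;
    \<open>G'\<close> adds the upper one, which the row estimate uses.\<close>
  define G' where "G' = {p \<in> G. inner_n n (fst p) (snd p) / real n \<le> 63/65}"
  interpret prob_space \<mu>
    unfolding \<mu>_def gaussian_matrices_def by (intro prob_space_PiM prob_space_std_normal)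
  have fin: "finite (cube n)" unfolding cube_def by (intro finite_PiE) auto
  have finG: "finite G" unfolding G_def using fin by (intro finite_SigmaI) auto
  have card_cube: "card (cube n) = 2 ^ n" unfolding cube_def by (simp add: card_PiE numeral_2_eq_2)
  have "real (card G) = (\<Sum>\<sigma>\<in>cube n. real (card {\<tau> \<in> cube n. 31/32 * real n \<le> inner_n n \<sigma> \<tau>}))"
    unfolding G_def using fin by (subst card_SigmaI) auto
  also have "\<dots> \<le> (\<Sum>\<sigma>\<in>cube n. (64/63) ^ n * 63 powr (real n / 64))"
    by (intro sum_mono count_close_sign_vectors)
  finally have cardG: "real (card G) \<le> 2 ^ n * ((64/63) ^ n * 63 powr (real n / 64))"
    by (simp add: card_cube)
  have finG': "finite G'" and cardG': "card G' \<le> card G" using finG by (auto simp: G'_def intro: card_mono)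
  \<comment> \<open>Index set of the union bound; the two angles are chosen separately, whence the
    square of \<open>card I\<close>.\<close>
  define T where "T = G' \<times> (I \<times> I)"
  have finT: "finite T" using finG' I by (simp add: T_def)
  define Ev where "Ev = (\<lambda>((\<sigma>\<^sub>1, \<sigma>\<^sub>2), (\<tau>\<^sub>1, \<tau>\<^sub>2)). pair_event n M \<sigma>\<^sub>1 \<sigma>\<^sub>2 \<tau>\<^sub>1 \<tau>\<^sub>2)"
  have Ev: "Ev t \<in> sets \<mu>" "prob (Ev t) \<le> 0.6355 ^ M" if "t \<in> T" for t
  proof -
    obtain \<sigma>\<^sub>1 \<sigma>\<^sub>2 \<tau>\<^sub>1 \<tau>\<^sub>2 where t: "t = ((\<sigma>\<^sub>1, \<sigma>\<^sub>2), (\<tau>\<^sub>1, \<tau>\<^sub>2))" by (metis surj_pair)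
    have "31/32 * real n \<le> inner_n n \<sigma>\<^sub>1 \<sigma>\<^sub>2" using that by (auto simp: t T_def G'_def G_def)
    moreover have "\<tau>\<^sub>1 \<in> {0..pi/2}" "\<tau>\<^sub>2 \<in> {0..pi/2}" using that I(1) by (auto simp: t T_def)
    ultimately have "0 \<le> inner_n n \<sigma>\<^sub>1 \<sigma>\<^sub>2 / real n" "\<tau>\<^sub>1 \<in> {0..pi/2}" "\<tau>\<^sub>2 \<in> {0..pi/2}" by simp_all
    then show "Ev t \<in> sets \<mu>" "prob (Ev t) \<le> 0.6355 ^ M"
      using that pair_event_bound[OF n, of \<sigma>\<^sub>1 \<sigma>\<^sub>2 \<tau>\<^sub>1 \<tau>\<^sub>2 M]
      by (auto simp: t T_def G'_def G_def Ev_def \<mu>_def)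
  qed
  have sub: "{\<omega> \<in> space \<mu>. overlap_set (63/65) (1/2080) 2 \<alpha> I n \<omega> \<noteq> {}} \<subseteq> (\<Union>t\<in>T. Ev t)"
  proof
    fix \<omega> assume "\<omega> \<in> {\<omega> \<in> space \<mu>. overlap_set (63/65) (1/2080) 2 \<alpha> I n \<omega> \<noteq> {}}"
    then obtain \<sigma> where \<omega>: "\<omega> \<in> space \<mu>" and \<sigma>: "\<sigma> \<in> overlap_set (63/65) (1/2080) 2 \<alpha> I n \<omega>" by auto
    from \<sigma> obtain \<tau> where \<tau>: "\<And>i. i \<in> {1..2} \<Longrightarrow> \<tau> i \<in> I \<and>
        linf_norm M (mat_vec n (interpolated_matrix \<omega> i (\<tau> i)) (\<sigma> i)) \<le> sqrt (real n)"
      unfolding overlap_set_def M_def by blast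
    have ov: "63/65 - 1/2080 \<le> inner_n n (\<sigma> 1) (\<sigma> 2) / real n" "inner_n n (\<sigma> 1) (\<sigma> 2) / real n \<le> 63/65"
      using \<sigma> unfolding overlap_set_def by auto
    have \<sigma>c: "\<sigma> 1 \<in> cube n" "\<sigma> 2 \<in> cube n" using \<sigma> unfolding overlap_set_def by auto
    have "((\<sigma> 1, \<sigma> 2), (\<tau> 1, \<tau> 2)) \<in> T"
      using \<sigma>c ov n \<tau>[of 1] \<tau>[of 2] by (auto simp: T_def G'_def G_def field_simps)
    moreover have "\<omega> \<in> Ev ((\<sigma> 1, \<sigma> 2), (\<tau> 1, \<tau> 2))"
      using \<omega> \<tau>[of 1] \<tau>[of 2] by (simp add: Ev_def pair_event_def \<mu>_def)
    ultimately show "\<omega> \<in> (\<Union>t\<in>T. Ev t)" by blast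
  qed
  have "prob_overlap_set_nonempty (63/65) (1/2080) 2 \<alpha> I n
      = prob {\<omega> \<in> space \<mu>. overlap_set (63/65) (1/2080) 2 \<alpha> I n \<omega> \<noteq> {}}"
    by (simp add: prob_overlap_set_nonempty_def \<mu>_def M_def)
  also have "\<dots> \<le> prob (\<Union>t\<in>T. Ev t)"
    using sub finT Ev by (intro finite_measure_mono) auto
  also have "\<dots> \<le> (\<Sum>t\<in>T. prob (Ev t))"
    using finT Ev by (intro measure_UNION_le) auto
  also have "\<dots> \<le> (\<Sum>t\<in>T. 0.6355 ^ M)" by (intro sum_mono Ev)
  also have "\<dots> = real (card G') * (real (card I))\<^sup>2 * 0.6355 ^ M"
    by (simp add: T_def card_cartesian_product power2_eq_square)
  also have "\<dots> \<le> 2 ^ n * ((64/63) ^ n * 63 powr (real n / 64)) * (real (card I))\<^sup>2 * 0.6355 ^ M"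
    using cardG cardG' by (intro mult_right_mono) auto
  finally show ?thesis by (simp add: M_def)
qed

text \<open>The floor loses less than one row, which costs the factor \<open>1 / q\<close>.\<close>

lemma power_num_constraints_le:
  fixes q :: real
  assumes "0 < q" "q < 1" "1.71 \<le> \<alpha>"
  shows "q ^ num_constraints \<alpha> n \<le> (q powr 1.71) powr real n / q"
proof -
  have "1.71 * real n \<le> real n * \<alpha>" using mult_right_mono[OF assms(3), of "real n"] by (simp add: mult.commute)
  then have "1.71 * real n - 1 \<le> real (num_constraints \<alpha> n)"
    unfolding num_constraints_def by linarith
  then have "q powr real (num_constraints \<alpha> n) \<le> q powr (1.71 * real n - 1)"
    using assms by (intro powr_mono') auto
  then show ?thesis using assms by (simp add: powr_realpow powr_diff powr_powr)
qed

theorem theorem2p2: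
  fixes \<alpha> :: real
  assumes "1.71 \<le> \<alpha>" and "\<alpha> \<le> alpha_c 1"
  shows "\<exists>\<eta> \<beta> c :: real. 0 < \<eta> \<and> \<eta> < \<beta> \<and> \<beta> < 1 \<and> 0 < c \<and>
    (\<exists>(c' :: real) (n0 :: nat). 0 < c' \<and>
      (\<forall>n\<ge>n0. \<forall>I :: real set.
         I \<subseteq> {0..pi / 2} \<and> finite I \<and> real (card I) \<le> 2 powr (c * real n) \<longrightarrow>
         prob_overlap_set_nonempty \<beta> \<eta> 2 \<alpha> I n \<le> 2 powr (- c' * real n)))"
proof -
  define B :: real where "B = 2 * (64/63) * 63 powr (1/64) * 0.6355 powr 1.71"
  have B: "0 < B" "B < 1" using exponential_rate_less_one by (simp_all add: B_def)
  \<comment> \<open>The rate \<open>4 * \<epsilon>\<close> of \<open>B\<close> is shared out: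
    \<open>2 * \<epsilon>\<close> pays for the two angles, \<epsilon> absorbs
    \<open>1 / 0.6355\<close>, and \<epsilon> remains as the final rate. Thus \<epsilon> serves as
    both \<open>c\<close> and \<open>c'\<close>.\<close>
  define \<epsilon> where "\<epsilon> = - log 2 B / 4"
  have \<epsilon>: "0 < \<epsilon>" and B_eq: "B = 2 powr (- 4 * \<epsilon>)" using B by (simp_all add: \<epsilon>_def)
  \<comment> \<open>From \<open>n0\<close> on, \<open>\<epsilon> * real n\<close> is at least 1, so
    that \<open>2 powr (\<epsilon> * real n)\<close> is at least 2 and exceeds
    \<open>1 / 0.6355\<close>.\<close>
  define n0 where "n0 = nat \<lceil>1 / \<epsilon>\<rceil> + 1"
  have bound: "prob_overlap_set_nonempty (63/65) (1/2080) 2 \<alpha> I n \<le> 2 powr (- \<epsilon> * real n)"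
    if n: "n0 \<le> n" and I: "I \<subseteq> {0..pi / 2}" "finite I" "real (card I) \<le> 2 powr (\<epsilon> * real n)" for n I
  proof -
    have n1: "0 < n" and "1 / \<epsilon> \<le> real n" using n unfolding n0_def by linarith+
    then have n\<epsilon>: "1 \<le> \<epsilon> * real n" using \<epsilon> by (simp add: field_simps)
    have "prob_overlap_set_nonempty (63/65) (1/2080) 2 \<alpha> I n
        \<le> 2 ^ n * ((64/63) ^ n * 63 powr (real n / 64)) * (real (card I))\<^sup>2 * 0.6355 ^ num_constraints \<alpha> n"
      by (rule prob_overlap_set_nonempty_le[OF n1 I(1,2)])
    also have "\<dots> \<le> 2 ^ n * ((64/63) ^ n * 63 powr (real n / 64)) * (2 powr (\<epsilon> * real n))\<^sup>2
        * ((0.6355 powr 1.71) powr real n / 0.6355)"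
      using I(3) assms(1) by (intro mult_mono power_mono power_num_constraints_le) auto
    also have "\<dots> = B powr real n * 2 powr (2 * \<epsilon> * real n) / 0.6355"
    proof -
      have "B powr real n = 2 ^ n * (64/63) ^ n * 63 powr (real n / 64) * (0.6355 powr 1.71) powr real n"
        using n1 unfolding B_def by (simp only: powr_mult powr_powr powr_realpow) (simp add: powr_powr)
      moreover have "(2 powr (\<epsilon> * real n))\<^sup>2 = 2 powr (2 * \<epsilon> * real n)"
        by (simp add: power2_eq_square mult.assoc flip: powr_add)
      ultimately show ?thesis by simp
    qed
    also have "B powr real n * 2 powr (2 * \<epsilon> * real n) = 2 powr (- 2 * \<epsilon> * real n)"
      by (simp add: B_eq powr_powr mult.assoc flip: powr_add)
    also have "\<dots> / 0.6355 \<le> 2 powr (- 2 * \<epsilon> * real n) * 2 powr (\<epsilon> * real n)"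
    proof -
      have "1 / 0.6355 \<le> (2::real) powr 1" by simp
      also have "\<dots> \<le> 2 powr (\<epsilon> * real n)" using n\<epsilon> by (intro powr_mono) auto
      finally have "2 powr (- 2 * \<epsilon> * real n) * (1 / 0.6355) \<le> 2 powr (- 2 * \<epsilon> * real n) * 2 powr (\<epsilon> * real n)"
        by (rule mult_left_mono) simp
      then show ?thesis by simp
    qed
    also have "\<dots> = 2 powr (- \<epsilon> * real n)" by (simp flip: powr_add)
    finally show ?thesis .
  qed
  show ?thesis
    by (intro exI[of _ "1/2080"] exI[of _ "63/65"] exI[of _ \<epsilon>] exI[of _ n0] conjI allI impI)
       (use \<epsilon> bound in auto)
qed

end
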